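(* The discriminant $\Delta_3$ of the binary cubic form $$P=ax^3+bx^2y+cxy^2+dy^3$$ is given by $$\Delta_3=b^2c^2-4ac^3-4b^3d+18abcd-27a^2d^2.$$ Moreover, the surface $\mathcal{D}_3:\Delta_3=0$ in $\mathbb{P}^3$ (with coordinates $a,b,c,d$) is rational, homeomorphic to $\mathbb{P}^1\times\mathbb{P}^1$, and has only points of multiplicity $\leq 2$.
   Context: The discriminant $\Delta_n\in\mathbb{C}[a_0,\dots,a_n]$ of the general binary form $a_0x^n+a_1x^{n-1}y+\dots+a_ny^n$ is the usual one: if $a_0\ne0$ and $\alpha_1,\dots,\alpha_n$ are the roots of the form in the variable $x$ after setting $y=1$, then $\Delta_n=a_0^{2n-2}\prod_{i<j}(\alpha_i-\alpha_j)^2$. It vanishes exactly on the forms having a multiple linear factor. Varieties are over $\mathbb{C}$ and "homeomorphic" refers to the classical (Euclidean) topology. *)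

theory Defs
  imports "HOL-Analysis.Analysis" "HOL-Library.Poly_Mapping" "HOL-Library.Extended_Nat"
    "HOL-Computational_Algebra.Polynomial"
begin

section \<open>Polynomials over the complex numbers in variables indexed by nat\<close>

text \<open>Exponent vectors are finitely supported functions; a polynomial is a finitely supported
  family of coefficients indexed by exponent vectors, with the convolution product of
  \<^theory>\<open>HOL-Library.Poly_Mapping\<close>.\<close>

type_synonym cpoly = "(nat \<Rightarrow>\<^sub>0 nat) \<Rightarrow>\<^sub>0 complex"

definition Const :: "complex \<Rightarrow> cpoly" where
  "Const c = Poly_Mapping.single 0 c"

definition Var :: "nat \<Rightarrow> cpoly" where
  "Var i = Poly_Mapping.single (Poly_Mapping.single i 1) 1"

definition monom_deg :: "(nat \<Rightarrow>\<^sub>0 nat) \<Rightarrow> nat" where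
  "monom_deg m = (\<Sum>i\<in>Poly_Mapping.keys m. Poly_Mapping.lookup m i)"

text \<open>Substitution of \<open>s i\<close> for the variable \<open>i\<close>, with \<open>h\<close> applied to the coefficients:
  \<open>h = id\<close> gives evaluation at a point, \<open>h = Const\<close> gives substitution of polynomials.\<close>

definition cpoly_subst :: "(complex \<Rightarrow> 'a::comm_ring_1) \<Rightarrow> (nat \<Rightarrow> 'a) \<Rightarrow> cpoly \<Rightarrow> 'a" where
  "cpoly_subst h s F =
     (\<Sum>m\<in>Poly_Mapping.keys F. h (Poly_Mapping.lookup F m) *
        (\<Prod>i\<in>Poly_Mapping.keys m. s i ^ Poly_Mapping.lookup m i))"

abbreviation ceval :: "(nat \<Rightarrow> complex) \<Rightarrow> cpoly \<Rightarrow> complex" where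
  "ceval \<equiv> cpoly_subst id"

text \<open>The ring of polynomials in the \<open>n + 1\<close> variables \<open>0, \<dots>, n\<close>, and its forms of degree \<open>d\<close>.\<close>

definition cpolys :: "nat \<Rightarrow> cpoly set" where
  "cpolys n = {F. \<forall>m\<in>Poly_Mapping.keys F. Poly_Mapping.keys m \<subseteq> {..n}}"

definition forms :: "nat \<Rightarrow> nat \<Rightarrow> cpoly set" where
  "forms n d = {F \<in> cpolys n. \<forall>m\<in>Poly_Mapping.keys F. monom_deg m = d}"


section \<open>The discriminant of a binary form\<close>

definition binary_form :: "nat \<Rightarrow> (nat \<Rightarrow> 'a) \<Rightarrow> 'a \<Rightarrow> 'a \<Rightarrow> 'a::comm_semiring_1" where
  "binary_form n a x y = (\<Sum>i\<le>n. a i * x ^ (n - i) * y ^ i)"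

text \<open>The hypothesis below is an identity of univariate polynomials, \<open>[:0, 1:]\<close> being the
  variable \<open>x\<close>, and says that \<open>\<alpha> 1, \<dots>, \<alpha> n\<close> are the roots, listed with multiplicity, of the
  form after setting \<open>y = 1\<close>. The polynomial \<open>D\<close> has \<open>Var i\<close> in the place of the coefficient
  \<open>a i\<close> of \<open>x ^ (n - i) * y ^ i\<close>.\<close>

definition is_discriminant :: "nat \<Rightarrow> cpoly \<Rightarrow> bool" where
  "is_discriminant n D \<longleftrightarrow> D \<in> cpolys n \<and>
     (\<forall>a \<alpha>. a 0 \<noteq> 0 \<longrightarrow>
        binary_form n (\<lambda>i. [:a i:]) [:0, 1:] 1 = smult (a 0) (\<Prod>i=1..n. [:- \<alpha> i, 1:]) \<longrightarrow>
        ceval a D = a 0 ^ (2 * n - 2) * (\<Prod>j=1..n. \<Prod>i=1..<j. (\<alpha> i - \<alpha> j)\<^sup>2))"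

definition discriminant :: "nat \<Rightarrow> cpoly" where
  "discriminant n = (THE D. is_discriminant n D)"


section \<open>Complex projective space\<close>

text \<open>Complex \<open>(n + 1)\<close>-space is the set of sequences vanishing beyond index \<open>n\<close> (the convention
  of \<^const>\<open>Euclidean_space\<close>); a point of projective \<open>n\<close>-space is the set of all its vectors of
  homogeneous coordinates.\<close>

definition nonzero_vecs :: "nat \<Rightarrow> (nat \<Rightarrow> complex) set" where
  "nonzero_vecs n = {v. (\<forall>i>n. v i = 0) \<and> (\<exists>i\<le>n. v i \<noteq> 0)}"

definition proj_pt :: "(nat \<Rightarrow> complex) \<Rightarrow> (nat \<Rightarrow> complex) set" where
  "proj_pt v = {\<lambda>i. c * v i | c. c \<noteq> 0}"

definition proj_space :: "nat \<Rightarrow> (nat \<Rightarrow> complex) set set" where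
  "proj_space n = proj_pt ` nonzero_vecs n"

text \<open>The classical topology: the quotient topology along \<^const>\<open>proj_pt\<close>. On
  \<open>nonzero_vecs n\<close> the topology of pointwise convergence is the Euclidean one.\<close>

definition proj_topology :: "nat \<Rightarrow> (nat \<Rightarrow> complex) set topology" where
  "proj_topology n = topology (\<lambda>U. U \<subseteq> proj_space n \<and>
     openin (top_of_set (nonzero_vecs n)) {v \<in> nonzero_vecs n. proj_pt v \<in> U})"

lemma openin_proj_topology:
  "openin (proj_topology n) U \<longleftrightarrow> U \<subseteq> proj_space n \<and>
     openin (top_of_set (nonzero_vecs n)) {v \<in> nonzero_vecs n. proj_pt v \<in> U}"
proof -
  let ?V = "nonzero_vecs n"
  have "istopology (\<lambda>U. U \<subseteq> proj_space n \<and> openin (top_of_set ?V) {v \<in> ?V. proj_pt v \<in> U})"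
    unfolding istopology_def
  proof (intro conjI allI impI)
    fix S T
    assume S: "S \<subseteq> proj_space n \<and> openin (top_of_set ?V) {v \<in> ?V. proj_pt v \<in> S}"
      and T: "T \<subseteq> proj_space n \<and> openin (top_of_set ?V) {v \<in> ?V. proj_pt v \<in> T}"
    show "S \<inter> T \<subseteq> proj_space n" using S by blast
    have "{v \<in> ?V. proj_pt v \<in> S \<inter> T} = {v \<in> ?V. proj_pt v \<in> S} \<inter> {v \<in> ?V. proj_pt v \<in> T}"
      by blast
    then show "openin (top_of_set ?V) {v \<in> ?V. proj_pt v \<in> S \<inter> T}"
      using S T by (simp only: openin_Int)
  next
    fix \<K>
    assume K: "\<forall>K\<in>\<K>. K \<subseteq> proj_space n \<and> openin (top_of_set ?V) {v \<in> ?V. proj_pt v \<in> K}"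
    show "\<Union>\<K> \<subseteq> proj_space n" using K by blast
    have "{v \<in> ?V. proj_pt v \<in> \<Union>\<K>} = \<Union>((\<lambda>K. {v \<in> ?V. proj_pt v \<in> K}) ` \<K>)"
      by blast
    moreover have "openin (top_of_set ?V) (\<Union>((\<lambda>K. {v \<in> ?V. proj_pt v \<in> K}) ` \<K>))"
      using K by (intro openin_Union) blast
    ultimately show "openin (top_of_set ?V) {v \<in> ?V. proj_pt v \<in> \<Union>\<K>}"
      by (simp only:)
  qed
  then show ?thesis
    by (simp add: proj_topology_def topology_inverse')
qed


section \<open>Projective varieties, rational maps and rationality\<close>

definition proj_zeros :: "nat \<Rightarrow> cpoly set \<Rightarrow> (nat \<Rightarrow> complex) set set" where
  "proj_zeros n S = {p \<in> proj_space n. \<forall>F\<in>S. \<forall>v\<in>p. ceval v F = 0}"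

definition zariski_closed :: "nat \<Rightarrow> (nat \<Rightarrow> complex) set set \<Rightarrow> bool" where
  "zariski_closed n X \<longleftrightarrow> (\<exists>S \<subseteq> (\<Union>d. forms n d). X = proj_zeros n S)"

definition proj_variety :: "nat \<Rightarrow> (nat \<Rightarrow> complex) set set \<Rightarrow> bool" where
  "proj_variety n X \<longleftrightarrow> zariski_closed n X \<and> X \<noteq> {} \<and>
     (\<forall>Y Z. zariski_closed n Y \<and> zariski_closed n Z \<and> X \<subseteq> Y \<union> Z \<longrightarrow> X \<subseteq> Y \<or> X \<subseteq> Z)"

text \<open>A rational map to projective \<open>m\<close>-space is represented by \<open>m + 1\<close> forms
  \<open>f 0, \<dots>, f m\<close> of one common degree. Where it is defined, all representatives
  \<open>v\<close> of \<open>p\<close> contribute the same point to the union in \<open>rat_apply\<close>.\<close>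

definition rat_defined :: "nat \<Rightarrow> (nat \<Rightarrow> cpoly) \<Rightarrow> (nat \<Rightarrow> complex) set \<Rightarrow> bool" where
  "rat_defined m f p \<longleftrightarrow> (\<exists>v\<in>p. \<exists>i\<le>m. ceval v (f i) \<noteq> 0)"

definition rat_apply ::
  "nat \<Rightarrow> (nat \<Rightarrow> cpoly) \<Rightarrow> (nat \<Rightarrow> complex) set \<Rightarrow> (nat \<Rightarrow> complex) set" where
  "rat_apply m f p = (\<Union>v\<in>p. proj_pt (\<lambda>i. if i \<le> m then ceval v (f i) else 0))"

definition rational_map :: "nat \<Rightarrow> (nat \<Rightarrow> complex) set set \<Rightarrow> nat \<Rightarrow> (nat \<Rightarrow> complex) set set \<Rightarrow>
    (nat \<Rightarrow> cpoly) \<Rightarrow> bool" where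
  "rational_map n X m Y f \<longleftrightarrow>
     (\<exists>d. \<forall>i\<le>m. f i \<in> forms n d) \<and>
     (\<exists>p\<in>X. rat_defined m f p) \<and>
     (\<forall>p\<in>X. rat_defined m f p \<longrightarrow> rat_apply m f p \<in> Y)"

text \<open>The composite of \<open>f\<close> (from \<open>X\<close> to projective \<open>m\<close>-space) and \<open>g\<close> (back to projective
  \<open>n\<close>-space) is defined on a nonempty open subset of \<open>X\<close> and is the identity there.\<close>

definition rat_left_inverse :: "nat \<Rightarrow> (nat \<Rightarrow> complex) set set \<Rightarrow> nat \<Rightarrow>
    (nat \<Rightarrow> cpoly) \<Rightarrow> (nat \<Rightarrow> cpoly) \<Rightarrow> bool" where
  "rat_left_inverse n X m g f \<longleftrightarrow>
     (\<exists>p\<in>X. rat_defined m f p \<and> rat_defined n g (rat_apply m f p)) \<and>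
     (\<forall>p\<in>X. rat_defined m f p \<and> rat_defined n g (rat_apply m f p) \<longrightarrow>
        rat_apply n g (rat_apply m f p) = p)"

definition birational ::
  "nat \<Rightarrow> (nat \<Rightarrow> complex) set set \<Rightarrow> nat \<Rightarrow> (nat \<Rightarrow> complex) set set \<Rightarrow> bool" where
  "birational n X m Y \<longleftrightarrow> proj_variety n X \<and> proj_variety m Y \<and>
     (\<exists>f g. rational_map n X m Y f \<and> rational_map m Y n X g \<and>
        rat_left_inverse n X m g f \<and> rat_left_inverse m Y n f g)"

definition rational_surface :: "nat \<Rightarrow> (nat \<Rightarrow> complex) set set \<Rightarrow> bool" where
  "rational_surface n X \<longleftrightarrow> birational n X 2 (proj_space 2)"


section \<open>Multiplicity of points of a hypersurface\<close>

definition order_at_origin :: "cpoly \<Rightarrow> enat" where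
  "order_at_origin g = (INF m\<in>Poly_Mapping.keys g. enat (monom_deg m))"

text \<open>The equation of the hypersurface \<open>F = 0\<close> in the affine chart where the \<open>i\<close>-th coordinate
  is \<open>1\<close>, after translating the point with homogeneous coordinates \<open>v\<close> to the origin.\<close>

definition local_equation :: "nat \<Rightarrow> (nat \<Rightarrow> complex) \<Rightarrow> cpoly \<Rightarrow> cpoly" where
  "local_equation i v F =
     cpoly_subst Const (\<lambda>j. if j = i then 1 else Const (v j / v i) + Var j) F"

text \<open>For a form \<open>F\<close> the value depends neither on the representative \<open>v\<close> of the point nor on the
  chart containing it; the chart used is that of the first nonzero coordinate.\<close>

definition multiplicity_at :: "cpoly \<Rightarrow> (nat \<Rightarrow> complex) set \<Rightarrow> enat" where
  "multiplicity_at F p =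
     (let v = (SOME v. v \<in> p); i = (LEAST i. v i \<noteq> 0)
      in order_at_origin (local_equation i v F))"

end

theory Submission
  imports Defs "HOL-Computational_Algebra.Fundamental_Theorem_Algebra"
begin

text \<open>
  A binary cubic form has vanishing discriminant iff it is \<open>l\<^sup>2 m\<close> for nonzero linear forms \<open>l\<close>
  and \<open>m\<close> (\<open>cubic_disc_square_times\<close>, \<open>cubic_disc_0_imp_square_times\<close>), and by unique
  factorization \<open>l\<close> and \<open>m\<close> are determined up to scalars (\<open>proj_pt_square_times_inj\<close>). All
  properties of the surface are read off from this parametrization by pairs \<open>(l, m)\<close>.

  \<^item> It is a continuous bijection from the product of two projective lines, which is compact, to a
    Hausdorff space, hence a homeomorphism. It is not an isomorphism of varieties: the surface is
    singular along the twisted cubic of the forms \<open>l\<^sup>3\<close>.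

  \<^item> In the chart \<open>l = x + u y\<close>, \<open>m = x + v y\<close> it is a map from the plane whose inverse is rational:
    the double root of a cubic is a rational function of the coefficients. Irreducibility holds
    because \<open>l\<close> and \<open>m\<close> can be moved linearly to any other pair, which joins any two points of the
    surface by a polynomial curve (\<open>proj_variety_if_curve_connected\<close>).

  \<^item> The multiplicities are bounded by restricting the local equation to a coordinate line on which
    a coefficient of degree at most two visibly survives (\<open>multiplicity_le\<close>).

  The formula for the discriminant has two parts. That the explicit quartic takes the right values
  is an identity in the roots. That the discriminant is determined by its values at the forms with
  \<open>a\<^sub>0 \<noteq> 0\<close> uses that such forms split into linear factors, and that a polynomial which vanishes at all
  points with \<open>a\<^sub>0 \<noteq> 0\<close> is zero (\<open>cpolys_eq_0\<close>).
\<close>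

section \<open>Substitution into polynomials as a ring homomorphism\<close>

definition monom_val :: "(nat \<Rightarrow> 'a::comm_ring_1) \<Rightarrow> (nat \<Rightarrow>\<^sub>0 nat) \<Rightarrow> 'a" where
  "monom_val s m = (\<Prod>i\<in>Poly_Mapping.keys m. s i ^ Poly_Mapping.lookup m i)"

lemma monom_val_superset:
  assumes "finite A" "Poly_Mapping.keys m \<subseteq> A"
  shows "monom_val s m = (\<Prod>i\<in>A. s i ^ Poly_Mapping.lookup m i)"
  unfolding monom_val_def using assms
  by (intro prod.mono_neutral_left) (auto simp: in_keys_iff)

lemma monom_val_0 [simp]: "monom_val s 0 = 1"
  by (simp add: monom_val_def)

lemma monom_val_add: "monom_val s (m + m') = monom_val s m * monom_val s m'"
proof -
  let ?A = "Poly_Mapping.keys m \<union> Poly_Mapping.keys m'"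
  have "monom_val s (m + m') = (\<Prod>i\<in>?A. s i ^ Poly_Mapping.lookup (m + m') i)"
    by (rule monom_val_superset) (auto dest: subsetD[OF keys_add])
  also have "\<dots> = (\<Prod>i\<in>?A. s i ^ Poly_Mapping.lookup m i) *
      (\<Prod>i\<in>?A. s i ^ Poly_Mapping.lookup m' i)"
    by (simp add: lookup_add power_add prod.distrib)
  also have "\<dots> = monom_val s m * monom_val s m'"
    by (simp add: monom_val_superset[of ?A])
  finally show ?thesis .
qed

lemma monom_val_scale: "monom_val (\<lambda>i. c * v i) m = c ^ monom_deg m * monom_val v m"
  by (simp add: monom_val_def monom_deg_def power_mult_distrib prod.distrib power_sum)

lemma sum_of_terms:
  "F = (\<Sum>m\<in>Poly_Mapping.keys F. Poly_Mapping.single m (Poly_Mapping.lookup F m))"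
  by (rule poly_mapping_eqI)
     (simp add: lookup_sum lookup_single when_def in_keys_iff)

text \<open>Substitution is used with three coefficient maps: into numbers (evaluation), into polynomials
  in the same variables (the local equations), and into univariate polynomials (restriction to a
  curve, and Kronecker substitution).\<close>

locale coeff_hom =
  fixes h :: "complex \<Rightarrow> 'a::comm_ring_1"
  assumes h_add: "h (x + y) = h x + h y" and h_mult: "h (x * y) = h x * h y" and h_1: "h 1 = 1"
begin

lemma h_0: "h 0 = 0"
  using h_add[of 0 0] by simp

lemma cpoly_subst_alt:
  "cpoly_subst h s F = (\<Sum>m\<in>Poly_Mapping.keys F. h (Poly_Mapping.lookup F m) * monom_val s m)"
  by (simp add: cpoly_subst_def monom_val_def)

lemma subst_single: "cpoly_subst h s (Poly_Mapping.single m c) = h c * monom_val s m"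
  by (simp add: cpoly_subst_alt h_0)

lemma subst_0 [simp]: "cpoly_subst h s 0 = 0"
  by (simp add: cpoly_subst_def)

lemma subst_add [simp]: "cpoly_subst h s (F + G) = cpoly_subst h s F + cpoly_subst h s G"
  unfolding cpoly_subst_alt
  by (rule setsum_keys_plus_distrib) (auto simp: h_0 h_add ring_distribs)

lemma subst_sum: "cpoly_subst h s (\<Sum>x\<in>A. F x) = (\<Sum>x\<in>A. cpoly_subst h s (F x))"
  by (induction A rule: infinite_finite_induct) auto

lemma subst_diff [simp]: "cpoly_subst h s (F - G) = cpoly_subst h s F - cpoly_subst h s G"
  using subst_add[of s "F - G" G] by (simp add: algebra_simps)

lemma subst_mult [simp]: "cpoly_subst h s (F * G) = cpoly_subst h s F * cpoly_subst h s G"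
proof -
  have "F * G = (\<Sum>m\<in>Poly_Mapping.keys F. \<Sum>m'\<in>Poly_Mapping.keys G.
      Poly_Mapping.single (m + m') (Poly_Mapping.lookup F m * Poly_Mapping.lookup G m'))"
    by (subst sum_of_terms[of F], subst sum_of_terms[of G]) (simp add: sum_product mult_single)
  then have "cpoly_subst h s (F * G) = (\<Sum>m\<in>Poly_Mapping.keys F. \<Sum>m'\<in>Poly_Mapping.keys G.
      (h (Poly_Mapping.lookup F m) * monom_val s m) * (h (Poly_Mapping.lookup G m') * monom_val s m'))"
    by (simp add: subst_sum subst_single monom_val_add h_mult mult_ac)
  also have "\<dots> = cpoly_subst h s F * cpoly_subst h s G"
    by (simp add: sum_product cpoly_subst_alt)
  finally show ?thesis .
qed

lemma subst_Const [simp]: "cpoly_subst h s (Const c) = h c"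
  by (simp add: Const_def subst_single)

lemma subst_1 [simp]: "cpoly_subst h s 1 = 1"
  using subst_Const[of s 1] by (simp add: Const_def h_1)

lemma subst_power [simp]: "cpoly_subst h s (F ^ k) = cpoly_subst h s F ^ k"
  by (induction k) auto

lemma subst_numeral [simp]: "cpoly_subst h s (numeral k) = numeral k"
proof -
  have "cpoly_subst h s (of_nat j) = of_nat j" for j
    by (induction j) auto
  from this[of "numeral k"] show ?thesis by simp
qed

lemma subst_Var [simp]: "cpoly_subst h s (Var i) = s i"
  by (simp add: Var_def subst_single h_1 monom_val_def)

end

interpretation eval: coeff_hom id
  by standard auto

interpretation cpoly_coeff: coeff_hom Const
  by standard (auto simp: Const_def single_add mult_single)

interpretation poly_coeff: coeff_hom "\<lambda>c. [:c:]"
  by standard auto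

lemma poly_subst:
  "poly (cpoly_subst (\<lambda>c. [:c:]) s F) t = ceval (\<lambda>i. poly (s i) t) F"
  by (simp add: cpoly_subst_def poly_sum poly_prod)


section \<open>Polynomials are determined by their values\<close>

text \<open>Uniqueness of the base \<open>N\<close> expansion: Kronecker substitution sends distinct monomials to
  distinct powers of one variable.\<close>

lemma digits_unique:
  fixes f g :: "nat \<Rightarrow> nat"
  assumes "(\<Sum>i<n. f i * N ^ i) = (\<Sum>i<n. g i * N ^ i)" "\<And>i. f i < N" "\<And>i. g i < N" "i < n"
  shows "f i = g i"
  using assms
proof (induction n arbitrary: f g i)
  case (Suc n)
  let ?S = "\<lambda>f. \<Sum>i<n. f (Suc i) * N ^ i"
  have split: "(\<Sum>i<Suc n. f i * N ^ i) = f 0 + N * ?S f" for f :: "nat \<Rightarrow> nat"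
    by (simp add: sum.lessThan_Suc_shift sum_distrib_left mult_ac del: sum.lessThan_Suc)
  have eq: "f 0 + N * ?S f = g 0 + N * ?S g"
    using Suc.prems(1) by (simp only: split)
  then have "(f 0 + N * ?S f) mod N = (g 0 + N * ?S g) mod N"
    by simp
  then have 0: "f 0 = g 0"
    using Suc.prems(2)[of 0] Suc.prems(3)[of 0] by simp
  with eq have "?S f = ?S g"
    using Suc.prems(2)[of 0] by auto
  with Suc.IH[of "\<lambda>i. f (Suc i)" "\<lambda>i. g (Suc i)"] Suc.prems have "f (Suc i) = g (Suc i)" if "i < n" for i
    using that by blast
  with 0 Suc.prems(4) show ?case by (cases i) auto
qed simp

lemma cpolys_diff: "F \<in> cpolys n \<Longrightarrow> G \<in> cpolys n \<Longrightarrow> F - G \<in> cpolys n"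
  unfolding cpolys_def using keys_diff[of F G] by blast

text \<open>Substitute \<open>t ^ N ^ i\<close> for the variable \<open>i\<close>, with \<open>N\<close> larger than all exponents of
  \<open>F\<close>. The result is a univariate polynomial with the same nonzero coefficients as \<open>F\<close>, which
  vanishes for all \<open>t \<noteq> 0\<close>. All points used have nonzero coordinate \<open>0\<close>, which is why
  the hypothesis may be restricted to these; for the discriminant it has to be, because its
  defining property speaks of forms of full degree in \<open>x\<close> only.\<close>

lemma cpolys_eq_0:
  assumes F: "F \<in> cpolys n" and 0: "\<And>a. a 0 \<noteq> 0 \<Longrightarrow> ceval a F = 0"
  shows "F = 0"
proof (rule ccontr)
  assume "F \<noteq> 0"
  then obtain m where m: "m \<in> Poly_Mapping.keys F"
    using poly_mapping_eqI[of F 0] by (auto simp: in_keys_iff)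
  \<comment> \<open>the sum of all degrees is a crude bound for every exponent that occurs\<close>
  define N where "N = Suc (\<Sum>m\<in>Poly_Mapping.keys F. monom_deg m)"
  have less: "Poly_Mapping.lookup k i < N" if "k \<in> Poly_Mapping.keys F" for k i
  proof -
    have "Poly_Mapping.lookup k i \<le> monom_deg k"
      by (cases "i \<in> Poly_Mapping.keys k")
         (auto simp: monom_deg_def in_keys_iff intro: member_le_sum)
    also have "\<dots> \<le> (\<Sum>m\<in>Poly_Mapping.keys F. monom_deg m)"
      using that by (intro member_le_sum) auto
    finally show ?thesis by (simp add: N_def)
  qed
  define code where "code k = (\<Sum>i<Suc n. Poly_Mapping.lookup k i * N ^ i)" for k
  define s where "s i = (Polynomial.monom 1 (N ^ i) :: complex poly)" for i
  have val: "monom_val s k = Polynomial.monom 1 (code k)" if "k \<in> Poly_Mapping.keys F" for k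
  proof -
    have "monom_val s k = (\<Prod>i<Suc n. s i ^ Poly_Mapping.lookup k i)"
      using F that by (intro monom_val_superset) (force simp: cpolys_def less_Suc_eq_le)+
    also have "\<dots> = (\<Prod>i<Suc n. Polynomial.monom 1 (Poly_Mapping.lookup k i * N ^ i))"
      by (simp only: s_def monom_power power_one mult.commute)
    also have "\<dots> = Polynomial.monom 1 (code k)"
      unfolding code_def by (induction n) (simp_all add: mult_monom)
    finally show ?thesis .
  qed
  have inj: "k = m" if "k \<in> Poly_Mapping.keys F" "code k = code m" for k
  proof (rule poly_mapping_eqI)
    fix i
    show "Poly_Mapping.lookup k i = Poly_Mapping.lookup m i"
    proof (cases "i \<le> n")
      case True
      then show ?thesis
        using digits_unique[of "Poly_Mapping.lookup k" N "Suc n" "Poly_Mapping.lookup m" i]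
          that m less by (simp add: code_def del: sum.lessThan_Suc)
    next
      case False
      then have "i \<notin> Poly_Mapping.keys k" "i \<notin> Poly_Mapping.keys m"
        using F m that(1) unfolding cpolys_def by blast+
      then show ?thesis by (simp add: in_keys_iff)
    qed
  qed
  let ?P = "cpoly_subst (\<lambda>c. [:c:]) s F"
  have "coeff ?P (code m) =
      (\<Sum>k\<in>Poly_Mapping.keys F. if k = m then Poly_Mapping.lookup F m else 0)"
    unfolding poly_coeff.cpoly_subst_alt coeff_sum
    by (rule sum.cong) (use inj in \<open>auto simp: val\<close>)
  also have "\<dots> \<noteq> 0"
    using m by (simp add: in_keys_iff)
  finally have "?P \<noteq> 0" by auto
  then have "finite {t. poly ?P t = 0}"
    by (rule poly_roots_finite)
  moreover have "UNIV - {0} \<subseteq> {t. poly ?P t = 0}"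
    using 0 by (auto simp: poly_subst s_def poly_monom)
  ultimately have "finite (UNIV - {0 :: complex})"
    by (rule finite_subset[rotated])
  then show False
    by (simp add: infinite_UNIV_char_0)
qed


section \<open>Forms\<close>

lemma monom_deg_0 [simp]: "monom_deg 0 = 0"
  by (simp add: monom_deg_def)

lemma monom_deg_add: "monom_deg (m + m') = monom_deg m + monom_deg m'"
  unfolding monom_deg_def by (rule setsum_keys_plus_distrib) auto

lemma forms_add: "F \<in> forms n d \<Longrightarrow> G \<in> forms n d \<Longrightarrow> F + G \<in> forms n d"
  unfolding forms_def cpolys_def using keys_add[of F G] by blast

lemma forms_diff: "F \<in> forms n d \<Longrightarrow> G \<in> forms n d \<Longrightarrow> F - G \<in> forms n d"
  unfolding forms_def cpolys_def using keys_diff[of F G] by blast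

lemma forms_mult:
  assumes F: "F \<in> forms n d" and G: "G \<in> forms n e"
  shows "F * G \<in> forms n (d + e)"
proof -
  have "Poly_Mapping.keys k \<subseteq> {..n} \<and> monom_deg k = d + e"
    if k: "k \<in> Poly_Mapping.keys (F * G)" for k
  proof -
    obtain m m' where m: "k = m + m'" "m \<in> Poly_Mapping.keys F" "m' \<in> Poly_Mapping.keys G"
      using keys_mult[of F G] k by auto
    then have "Poly_Mapping.keys m \<subseteq> {..n}" "Poly_Mapping.keys m' \<subseteq> {..n}"
      "monom_deg m = d" "monom_deg m' = e"
      using F G by (auto simp: forms_def cpolys_def)
    with m(1) show ?thesis
      using keys_add[of m m'] by (auto simp: monom_deg_add)
  qed
  then show ?thesis
    unfolding forms_def cpolys_def by blast
qed

lemma forms_Var: "i \<le> n \<Longrightarrow> Var i \<in> forms n 1"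
  by (simp add: forms_def cpolys_def Var_def monom_deg_def)

lemma forms_numeral: "numeral k \<in> forms n 0"
proof -
  have "Poly_Mapping.keys (numeral k :: cpoly) = {0}"
    by (subst single_numeral[symmetric]) (simp del: single_numeral)
  then show ?thesis
    by (simp add: forms_def cpolys_def)
qed

lemma forms_power: "F \<in> forms n d \<Longrightarrow> F ^ k \<in> forms n (k * d)"
proof (induction k)
  case 0
  then show ?case by (simp add: forms_def cpolys_def)
next
  case (Suc k)
  then show ?case using forms_mult[of F n d "F ^ k" "k * d"] by simp
qed

text \<open>The degree is a separate premise, so that the rules apply to a concrete product whose
  degree is given as a numeral; the equation is checked last.\<close>

lemma forms_mult': "F \<in> forms n d \<Longrightarrow> G \<in> forms n e \<Longrightarrow> d + e = k \<Longrightarrow> F * G \<in> forms n k"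
  using forms_mult by blast

lemma forms_power': "F \<in> forms n d \<Longrightarrow> k * d = e \<Longrightarrow> F ^ k \<in> forms n e"
  using forms_power by blast

lemmas forms_intros = forms_add forms_diff forms_mult' forms_power' forms_Var forms_numeral

lemma ceval_homogeneous:
  assumes "F \<in> forms n d"
  shows "ceval (\<lambda>i. c * v i) F = c ^ d * ceval v F"
  using assms unfolding eval.cpoly_subst_alt sum_distrib_left
  by (intro sum.cong) (auto simp: forms_def monom_val_scale)


section \<open>The discriminant of the binary cubic form\<close>

text \<open>The formula is kept polymorphic: it is applied to the coordinate variables, to numbers, and
  to univariate polynomials.\<close>

definition cubic_disc :: "'a::comm_ring_1 \<Rightarrow> 'a \<Rightarrow> 'a \<Rightarrow> 'a \<Rightarrow> 'a" where
  "cubic_disc a b c d =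
     b^2 * c^2 - 4 * a * c^3 - 4 * b^3 * d + 18 * a * b * c * d - 27 * a^2 * d^2"

lemma (in coeff_hom) subst_cubic_disc [simp]:
  "cpoly_subst h s (cubic_disc A B C D) = cubic_disc
     (cpoly_subst h s A) (cpoly_subst h s B) (cpoly_subst h s C) (cpoly_subst h s D)"
  by (simp add: cubic_disc_def)

abbreviation cubic_disc_form :: cpoly where
  "cubic_disc_form \<equiv> cubic_disc (Var 0) (Var 1) (Var 2) (Var 3)"

lemma cubic_disc_form_in_forms: "cubic_disc_form \<in> forms 3 4"
  unfolding cubic_disc_def by (rule forms_intros | simp)+

lemma binary_cubic: "binary_form 3 (\<lambda>i. [:a i:]) [:0, 1:] 1 = [:a 3, a 2, a 1, a 0:]"
  by (simp add: binary_form_def numeral_eq_Suc)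

lemma small_prods:
  fixes f :: "nat \<Rightarrow> 'a::comm_monoid_mult"
  shows "(\<Prod>i=1..3. f i) = f 1 * (f 2 * f 3)" "(\<Prod>i=1..<3. f i) = f 1 * f 2"
    "(\<Prod>i=1..<2. f i) = f 1" "(\<Prod>i=1..<1. f i) = 1"
proof -
  have "{1..3} = {1, 2, 3 :: nat}" "{1..<3} = {1, 2 :: nat}" "{1..<2} = {1 :: nat}"
    by auto
  then show "(\<Prod>i=1..3. f i) = f 1 * (f 2 * f 3)" "(\<Prod>i=1..<3. f i) = f 1 * f 2"
    "(\<Prod>i=1..<2. f i) = f 1" "(\<Prod>i=1..<1. f i) = 1"
    by (simp_all only:) simp_all
qed

text \<open>Vieta's formulas.\<close>

lemma binary_cubic_roots_iff:
  "binary_form 3 (\<lambda>i. [:a i:]) [:0, 1:] 1 = smult (a 0) (\<Prod>i=1..3. [:- \<alpha> i, 1:]) \<longleftrightarrow>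
     a 1 = - a 0 * (\<alpha> 1 + \<alpha> 2 + \<alpha> 3) \<and>
     a 2 = a 0 * (\<alpha> 1 * \<alpha> 2 + \<alpha> 1 * \<alpha> 3 + \<alpha> 2 * \<alpha> 3) \<and>
     a 3 = - a 0 * (\<alpha> 1 * \<alpha> 2 * \<alpha> 3)" for a \<alpha> :: "nat \<Rightarrow> complex"
proof -
  have "smult (a 0) (\<Prod>i=1..3. [:- \<alpha> i, 1:]) =
    [:- a 0 * (\<alpha> 1 * \<alpha> 2 * \<alpha> 3), a 0 * (\<alpha> 1 * \<alpha> 2 + \<alpha> 1 * \<alpha> 3 + \<alpha> 2 * \<alpha> 3),
      - a 0 * (\<alpha> 1 + \<alpha> 2 + \<alpha> 3), a 0:]"
    unfolding small_prods by (simp add: algebra_simps)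
  then show ?thesis
    unfolding binary_cubic by auto
qed

lemma binary_cubic_roots_exist:
  fixes a :: "nat \<Rightarrow> complex"
  assumes "a 0 \<noteq> 0"
  obtains \<alpha> :: "nat \<Rightarrow> complex" where
    "binary_form 3 (\<lambda>i. [:a i:]) [:0, 1:] 1 = smult (a 0) (\<Prod>i=1..3. [:- \<alpha> i, 1:])"
proof -
  let ?p = "[:a 3, a 2, a 1, a 0:]"
  obtain r where "smult (lead_coeff ?p) (\<Prod>i<degree ?p. [:- r i, 1:]) = ?p"
    by (rule complex_poly_decompose')
  moreover have "degree ?p = 3" "lead_coeff ?p = a 0"
    using assms by (simp_all add: numeral_3_eq_3)
  moreover have "(\<Prod>i<3. [:- r i, 1:]) = (\<Prod>i=1..3. [:- r (i - 1), 1:])"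
    by (simp add: numeral_eq_Suc atLeastAtMostSuc_conv)
  ultimately show ?thesis
    using that[of "\<lambda>i. r (i - 1 :: nat)"] by (simp only: binary_cubic)
qed

lemma cubic_disc_roots:
  fixes a \<alpha> :: "nat \<Rightarrow> complex"
  assumes "binary_form 3 (\<lambda>i. [:a i:]) [:0, 1:] 1 = smult (a 0) (\<Prod>i=1..3. [:- \<alpha> i, 1:])"
  shows "cubic_disc (a 0) (a 1) (a 2) (a 3) =
    a 0 ^ (2 * 3 - 2) * (\<Prod>j=1..3. \<Prod>i=1..<j. (\<alpha> i - \<alpha> j)\<^sup>2)"
proof -
  have "a 0 ^ (2 * 3 - 2) * (\<Prod>j=1..3. \<Prod>i=1..<j. (\<alpha> i - \<alpha> j)\<^sup>2) =
      a 0 ^ 4 * ((\<alpha> 1 - \<alpha> 2)\<^sup>2 * ((\<alpha> 1 - \<alpha> 3)\<^sup>2 * (\<alpha> 2 - \<alpha> 3)\<^sup>2))"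
    unfolding small_prods by simp
  moreover have "cubic_disc (a 0) (a 1) (a 2) (a 3) = \<dots>"
    using assms unfolding binary_cubic_roots_iff cubic_disc_def by algebra
  ultimately show ?thesis by (simp only:)
qed

text \<open>The formula has the defining property of the discriminant by Vieta. It is the only such
  polynomial since every cubic with \<open>a 0 \<noteq> 0\<close> has a full list of roots, so that the property
  fixes all values at these cubics.\<close>

theorem discriminant_3: "discriminant 3 = cubic_disc_form"
  unfolding discriminant_def
proof (rule the_equality)
  show "is_discriminant 3 cubic_disc_form"
    unfolding is_discriminant_def
    using cubic_disc_form_in_forms cubic_disc_roots by (simp add: forms_def)
next
  fix D assume D: "is_discriminant 3 D"
  have "D - cubic_disc_form = 0"
  proof (rule cpolys_eq_0)
    show "D - cubic_disc_form \<in> cpolys 3"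
      using D cubic_disc_form_in_forms by (intro cpolys_diff) (auto simp: is_discriminant_def forms_def)
    fix a :: "nat \<Rightarrow> complex" assume "a 0 \<noteq> 0"
    moreover obtain \<alpha> :: "nat \<Rightarrow> complex" where
      "binary_form 3 (\<lambda>i. [:a i:]) [:0, 1:] 1 = smult (a 0) (\<Prod>i=1..3. [:- \<alpha> i, 1:])"
      using binary_cubic_roots_exist[of a] \<open>a 0 \<noteq> 0\<close> by metis
    ultimately show "ceval a (D - cubic_disc_form) = 0"
      using D cubic_disc_roots[of a \<alpha>] by (simp add: is_discriminant_def)
  qed
  then show "D = cubic_disc_form" by simp
qed


section \<open>Points of projective space and their images under rational maps\<close>

lemma proj_pt_self: "v \<in> proj_pt v"
  by (auto simp: proj_pt_def intro!: exI[of _ 1])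

lemma proj_pt_scale:
  assumes "c \<noteq> 0"
  shows "proj_pt (\<lambda>i. c * v i) = proj_pt v"
proof -
  have "\<exists>c'. (\<lambda>i. k * v i) = (\<lambda>i. c' * (c * v i)) \<and> c' \<noteq> 0" if "k \<noteq> 0" for k
    using assms that by (intro exI[of _ "k / c"]) auto
  moreover have "\<exists>c'. (\<lambda>i. k * (c * v i)) = (\<lambda>i. c' * v i) \<and> c' \<noteq> 0" if "k \<noteq> 0" for k
    using assms that by (intro exI[of _ "k * c"]) auto
  ultimately show ?thesis
    unfolding proj_pt_def by auto
qed

lemma proj_pt_eq_iff: "proj_pt v = proj_pt w \<longleftrightarrow> (\<exists>c. c \<noteq> 0 \<and> v = (\<lambda>i. c * w i))"
proof
  assume "proj_pt v = proj_pt w"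
  then have "v \<in> proj_pt w" using proj_pt_self by blast
  then show "\<exists>c. c \<noteq> 0 \<and> v = (\<lambda>i. c * w i)" by (auto simp: proj_pt_def)
qed (auto simp: proj_pt_scale)

lemma proj_pt_in_proj_space: "v \<in> nonzero_vecs n \<Longrightarrow> proj_pt v \<in> proj_space n"
  by (simp add: proj_space_def)

text \<open>For forms, vanishing at one vector of homogeneous coordinates is vanishing at all of them.
  This and the two lemmas on rational maps below reduce all statements about points to statements
  about one coordinate vector.\<close>

lemma proj_pt_in_proj_zeros_iff:
  assumes "S \<subseteq> (\<Union>d. forms n d)" "v \<in> nonzero_vecs n"
  shows "proj_pt v \<in> proj_zeros n S \<longleftrightarrow> (\<forall>F\<in>S. ceval v F = 0)"
proof
  assume "\<forall>F\<in>S. ceval v F = 0"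
  moreover have "ceval (\<lambda>i. c * v i) F = 0" if "F \<in> S" "ceval v F = 0" for F c
    using assms(1) that by (auto dest!: subsetD simp: ceval_homogeneous)
  ultimately show "proj_pt v \<in> proj_zeros n S"
    using proj_pt_in_proj_space[OF assms(2)] by (auto simp: proj_zeros_def proj_pt_def)
qed (auto simp: proj_zeros_def proj_pt_self)

definition apply_forms :: "nat \<Rightarrow> (nat \<Rightarrow> cpoly) \<Rightarrow> (nat \<Rightarrow> complex) \<Rightarrow> nat \<Rightarrow> complex" where
  "apply_forms m f v = (\<lambda>i. if i \<le> m then ceval v (f i) else 0)"

lemma apply_forms_homogeneous:
  assumes "\<And>i. i \<le> m \<Longrightarrow> f i \<in> forms n d"
  shows "apply_forms m f (\<lambda>i. c * v i) = (\<lambda>i. c ^ d * apply_forms m f v i)"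
  using ceval_homogeneous[OF assms] by (auto simp: apply_forms_def)

lemma rat_defined_proj_pt:
  assumes f: "\<And>i. i \<le> m \<Longrightarrow> f i \<in> forms n d"
  shows "rat_defined m f (proj_pt v) \<longleftrightarrow> apply_forms m f v \<in> nonzero_vecs m"
proof -
  have "apply_forms m f v \<in> nonzero_vecs m \<longleftrightarrow> (\<exists>i\<le>m. ceval v (f i) \<noteq> 0)"
    by (auto simp: nonzero_vecs_def apply_forms_def)
  moreover have "(\<exists>i\<le>m. ceval w (f i) \<noteq> 0) \<longleftrightarrow> (\<exists>i\<le>m. ceval v (f i) \<noteq> 0)" if "w \<in> proj_pt v" for w
    using that ceval_homogeneous[OF f] by (auto simp: proj_pt_def)
  ultimately show ?thesis
    using proj_pt_self[of v] unfolding rat_defined_def by blast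
qed

lemma rat_apply_proj_pt:
  assumes f: "\<And>i. i \<le> m \<Longrightarrow> f i \<in> forms n d"
  shows "rat_apply m f (proj_pt v) = proj_pt (apply_forms m f v)"
proof -
  have "proj_pt (apply_forms m f w) = proj_pt (apply_forms m f v)" if "w \<in> proj_pt v" for w
    using that by (auto simp: proj_pt_def[of v] apply_forms_homogeneous[OF f] proj_pt_scale)
  then show ?thesis
    using proj_pt_self[of v] unfolding rat_apply_def apply_forms_def[symmetric] by blast
qed


section \<open>Irreducibility\<close>

text \<open>A closed set is irreducible if any two of its points lie on a polynomial curve inside it: forms
  \<open>F\<close>, \<open>G\<close> that witness \<open>p \<notin> Y\<close> and \<open>q \<notin> Z\<close> restrict to nonzero univariate polynomials on
  the curve from \<open>p\<close> to \<open>q\<close>, so almost all points of the curve lie neither in \<open>Y\<close> nor in \<open>Z\<close>.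
  The curve is given by homogeneous coordinates, which may vanish simultaneously for some
  parameters; such parameters are excluded by one further nonzero polynomial, a coordinate \<open>c j\<close>.\<close>

lemma proj_variety_if_curve_connected:
  fixes X :: "(nat \<Rightarrow> complex) set set"
  assumes X: "zariski_closed n X" "X \<noteq> {}"
    and curve: "\<And>p q. p \<in> X \<Longrightarrow> q \<in> X \<Longrightarrow> \<exists>c :: nat \<Rightarrow> complex poly.
      (\<forall>i>n. c i = 0) \<and>
      (\<lambda>i. poly (c i) 0) \<in> nonzero_vecs n \<and> p = proj_pt (\<lambda>i. poly (c i) 0) \<and>
      (\<lambda>i. poly (c i) 1) \<in> nonzero_vecs n \<and> q = proj_pt (\<lambda>i. poly (c i) 1) \<and>
      (\<forall>t. (\<lambda>i. poly (c i) t) \<in> nonzero_vecs n \<longrightarrow> proj_pt (\<lambda>i. poly (c i) t) \<in> X)"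
  shows "proj_variety n X"
  unfolding proj_variety_def
proof (intro conjI allI impI X)
  fix Y Z assume YZ: "zariski_closed n Y \<and> zariski_closed n Z \<and> X \<subseteq> Y \<union> Z"
  then obtain S T where S: "S \<subseteq> (\<Union>d. forms n d)" "Y = proj_zeros n S"
    and T: "T \<subseteq> (\<Union>d. forms n d)" "Z = proj_zeros n T"
    unfolding zariski_closed_def by metis
  show "X \<subseteq> Y \<or> X \<subseteq> Z"
  proof (rule ccontr)
    assume "\<not> (X \<subseteq> Y \<or> X \<subseteq> Z)"
    then obtain p q where pq: "p \<in> X" "p \<notin> Y" "q \<in> X" "q \<notin> Z" by auto
    then obtain c where c: "\<forall>i>n. c i = 0"
      "(\<lambda>i. poly (c i) 0) \<in> nonzero_vecs n" "p = proj_pt (\<lambda>i. poly (c i) 0)"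
      "(\<lambda>i. poly (c i) 1) \<in> nonzero_vecs n" "q = proj_pt (\<lambda>i. poly (c i) 1)"
      "\<And>t. (\<lambda>i. poly (c i) t) \<in> nonzero_vecs n \<Longrightarrow> proj_pt (\<lambda>i. poly (c i) t) \<in> X"
      using curve[of p q] by metis
    obtain F where F: "F \<in> S" "ceval (\<lambda>i. poly (c i) 0) F \<noteq> 0"
      using pq(2) proj_pt_in_proj_zeros_iff[OF S(1) c(2)] unfolding S(2) c(3) by auto
    obtain G where G: "G \<in> T" "ceval (\<lambda>i. poly (c i) 1) G \<noteq> 0"
      using pq(4) proj_pt_in_proj_zeros_iff[OF T(1) c(4)] unfolding T(2) c(5) by auto
    obtain j where j: "j \<le> n" "poly (c j) 0 \<noteq> 0"
      using c(2) by (auto simp: nonzero_vecs_def)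
    let ?A = "cpoly_subst (\<lambda>c. [:c:]) c F" and ?B = "cpoly_subst (\<lambda>c. [:c:]) c G"
    have "poly ?A 0 \<noteq> 0" "poly ?B 1 \<noteq> 0"
      using F G by (simp_all add: poly_subst)
    with j(2) have "?A * ?B * c j \<noteq> 0"
      by (auto simp del: poly_0_coeff_0)
    then obtain t where "poly (?A * ?B * c j) t \<noteq> 0"
      using poly_all_0_iff_0 by blast
    then have t: "ceval (\<lambda>i. poly (c i) t) F \<noteq> 0" "ceval (\<lambda>i. poly (c i) t) G \<noteq> 0"
      "poly (c j) t \<noteq> 0"
      by (auto simp: poly_subst)
    have v: "(\<lambda>i. poly (c i) t) \<in> nonzero_vecs n"
      using t(3) j(1) c(1) by (auto simp: nonzero_vecs_def)
    then have "proj_pt (\<lambda>i. poly (c i) t) \<in> Y \<union> Z"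
      using c(6) YZ by blast
    with t F(1) G(1) show False
      using proj_pt_in_proj_zeros_iff[OF S(1) v] proj_pt_in_proj_zeros_iff[OF T(1) v]
      unfolding S(2) T(2) by blast
  qed
qed

lemma proj_variety_proj_space: "proj_variety n (proj_space n)"
proof (rule proj_variety_if_curve_connected)
  show "zariski_closed n (proj_space n)"
    unfolding zariski_closed_def by (intro exI[of _ "{}"]) (simp add: proj_zeros_def)
  have "(\<lambda>i. if i = 0 then 1 else 0) \<in> nonzero_vecs n"
    by (auto simp: nonzero_vecs_def)
  then show "proj_space n \<noteq> {}"
    by (auto simp: proj_space_def)
next
  fix p q assume "p \<in> proj_space n" "q \<in> proj_space n"
  then obtain v w where "v \<in> nonzero_vecs n" "p = proj_pt v" "w \<in> nonzero_vecs n" "q = proj_pt w"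
    by (auto simp: proj_space_def)
  then show "\<exists>c :: nat \<Rightarrow> complex poly. (\<forall>i>n. c i = 0) \<and>
      (\<lambda>i. poly (c i) 0) \<in> nonzero_vecs n \<and> p = proj_pt (\<lambda>i. poly (c i) 0) \<and>
      (\<lambda>i. poly (c i) 1) \<in> nonzero_vecs n \<and> q = proj_pt (\<lambda>i. poly (c i) 1) \<and>
      (\<forall>t. (\<lambda>i. poly (c i) t) \<in> nonzero_vecs n \<longrightarrow> proj_pt (\<lambda>i. poly (c i) t) \<in> proj_space n)"
    by (intro exI[of _ "\<lambda>i. [:v i, w i - v i:]"]) (auto simp: nonzero_vecs_def proj_space_def)
qed


section \<open>The classical topology of projective space\<close>

lemma topspace_proj_topology [simp]: "topspace (proj_topology n) = proj_space n"
proof -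
  have "{v \<in> nonzero_vecs n. proj_pt v \<in> proj_space n} = nonzero_vecs n"
    by (auto simp: proj_space_def)
  then have "openin (proj_topology n) (proj_space n)"
    by (simp add: openin_proj_topology)
  then show ?thesis
    by (metis openin_proj_topology openin_subset openin_topspace subset_antisym)
qed

lemma quotient_map_proj_pt: "quotient_map (top_of_set (nonzero_vecs n)) (proj_topology n) proj_pt"
  by (auto simp: quotient_map_def openin_proj_topology proj_space_def)

text \<open>The map \<open>v \<mapsto> v v\<^sup>* / \<bar>v\<bar>\<^sup>2\<close>, which sends a line to the orthogonal projection onto it, is a
  continuous injection of projective space into a space of matrices.\<close>

lemma Hausdorff_proj_topology: "Hausdorff_space (proj_topology n)"
proof -
  define N where "N v = complex_of_real (\<Sum>k\<le>n. (cmod (v k))\<^sup>2)" for v :: "nat \<Rightarrow> complex"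
  define P where "P v = (\<lambda>i j. v i * cnj (v j) / N v)" for v :: "nat \<Rightarrow> complex"
  have N: "N v \<noteq> 0" if v: "v \<in> nonzero_vecs n" for v
  proof -
    obtain k where "k \<le> n" "v k \<noteq> 0"
      using v by (auto simp: nonzero_vecs_def)
    then have "(\<Sum>k\<le>n. (cmod (v k))\<^sup>2) > 0"
      by (intro sum_pos2[of _ k]) auto
    then show ?thesis
      unfolding N_def of_real_eq_0_iff by simp
  qed
  have coord: "continuous_on A (\<lambda>v. v i)" for A :: "(nat \<Rightarrow> complex) set" and i
    by (rule continuous_on_subset[OF continuous_on_product_coordinates subset_UNIV])
  have cont: "continuous_on (nonzero_vecs n) P"
    unfolding P_def
    by (intro continuous_on_coordinatewise_then_product continuous_intros coord)
       (use N in \<open>auto simp: N_def intro!: continuous_intros coord\<close>)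
  have scale: "P v = P w" if eq: "proj_pt v = proj_pt w" for v w
  proof -
    obtain c where c: "c \<noteq> 0" "v = (\<lambda>i. c * w i)"
      using eq by (auto simp: proj_pt_eq_iff)
    have "c * cnj c = complex_of_real ((cmod c)\<^sup>2)"
      by (simp only: complex_norm_square)
    then have "N v = c * cnj c * N w"
      by (simp add: c(2) N_def norm_mult power_mult_distrib sum_distrib_left)
    then show ?thesis
      using c(1) by (simp add: P_def c(2))
  qed
  have "continuous_map (top_of_set (nonzero_vecs n)) euclidean P"
    using cont by (simp add: continuous_map_iff_continuous)
  then obtain g where g: "continuous_map (proj_topology n) euclidean g"
    "\<And>v. v \<in> nonzero_vecs n \<Longrightarrow> g (proj_pt v) = P v"
    using quotient_map_lift_exists[OF quotient_map_proj_pt, of n euclidean P] scale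
    by (metis topspace_euclidean_subtopology)
  have "inj_on g (proj_space n)"
  proof (rule inj_onI)
    fix p q assume p: "p \<in> proj_space n" and q: "q \<in> proj_space n" and eq: "g p = g q"
    obtain v w where v: "v \<in> nonzero_vecs n" "p = proj_pt v"
      and w: "w \<in> nonzero_vecs n" "q = proj_pt w"
      using p q by (auto simp: proj_space_def)
    have P: "v i * cnj (v j) / N v = w i * cnj (w j) / N w" for i j
      using eq g(2) v w by (simp add: P_def fun_eq_iff)
    obtain j where j: "v j \<noteq> 0"
      using v(1) by (auto simp: nonzero_vecs_def)
    define c where "c = cnj (w j) * N v / (cnj (v j) * N w)"
    have "v i = c * w i" for i
      using P[of i j] j N[OF v(1)] N[OF w(1)] by (simp add: c_def field_simps)
    moreover from this[of j] j have "c \<noteq> 0" by auto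
    ultimately show "p = q"
      unfolding v(2) w(2) proj_pt_eq_iff by auto
  qed
  then show ?thesis
    by (intro Hausdorff_space_injective_preimage[OF Hausdorff_space_euclidean g(1)]) simp
qed

text \<open>Representatives of maximum norm \<open>1\<close> with a maximal coordinate equal to \<open>1\<close>. Every point has
  one, and they form a finite union of compact boxes.\<close>

definition unit_vecs :: "nat \<Rightarrow> (nat \<Rightarrow> complex) set" where
  "unit_vecs n = (\<Union>i\<le>n. Pi UNIV
     (\<lambda>j. if j = i then {1} else if j \<le> n then cball 0 1 else {0}))"

lemma compact_unit_vecs: "compact (unit_vecs n)"
proof -
  have "compact (Pi UNIV (\<lambda>j. if j = i then {1} else if j \<le> n then cball 0 1 else {0 :: complex}))"
    for i :: nat
  proof -
    have "compactin (product_topology (\<lambda>_. euclidean) UNIV)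
        (PiE UNIV (\<lambda>j. if j = i then {1} else if j \<le> n then cball 0 1 else {0 :: complex}))"
      by (subst compactin_PiE) auto
    then show ?thesis
      by (simp add: euclidean_product_topology PiE_UNIV_domain)
  qed
  then show ?thesis
    unfolding unit_vecs_def by (intro compact_UN) auto
qed

lemma unit_vecs_subset: "unit_vecs n \<subseteq> nonzero_vecs n"
proof
  fix v assume "v \<in> unit_vecs n"
  then obtain i where i: "i \<le> n"
    and v: "\<And>j. v j \<in> (if j = i then {1} else if j \<le> n then cball 0 1 else {0})"
    unfolding unit_vecs_def by blast
  have "v i = 1" using v[of i] by simp
  moreover have "v j = 0" if "j > n" for j
    using v[of j] i that by (simp split: if_splits)
  ultimately show "v \<in> nonzero_vecs n"
    using i by (auto simp: nonzero_vecs_def)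
qed

lemma proj_pt_unit_vecs: "proj_pt ` unit_vecs n = proj_space n"
proof
  show "proj_pt ` unit_vecs n \<subseteq> proj_space n"
    using unit_vecs_subset by (auto simp: proj_space_def)
  show "proj_space n \<subseteq> proj_pt ` unit_vecs n"
  proof
    fix p assume "p \<in> proj_space n"
    then obtain v where v: "v \<in> nonzero_vecs n" "p = proj_pt v"
      by (auto simp: proj_space_def)
    let ?M = "Max ((\<lambda>i. cmod (v i)) ` {..n})"
    have "?M \<in> (\<lambda>i. cmod (v i)) ` {..n}"
      by (rule Max_in) auto
    then obtain i where i: "i \<le> n" "cmod (v i) = ?M"
      by (metis (no_types, lifting) atMost_iff imageE)
    then have le: "cmod (v j) \<le> cmod (v i)" if "j \<le> n" for j
      using that by simp
    have "v i \<noteq> 0"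
      using v(1) le by (auto simp: nonzero_vecs_def)
    moreover have "cmod (inverse (v i) * v j) \<le> 1" if "j \<le> n" for j
      using le[OF that] \<open>v i \<noteq> 0\<close> by (simp add: norm_mult norm_inverse norm_divide divide_simps)
    ultimately have "(\<lambda>j. inverse (v i) * v j) \<in> unit_vecs n"
      using i(1) v(1) unfolding unit_vecs_def
      by (intro UN_I[of i]) (auto simp: nonzero_vecs_def)
    moreover have "p = proj_pt (\<lambda>j. inverse (v i) * v j)"
      using v(2) \<open>v i \<noteq> 0\<close> by (simp add: proj_pt_scale)
    ultimately show "p \<in> proj_pt ` unit_vecs n" by blast
  qed
qed


section \<open>Cubics with a double factor\<close>

text \<open>Coordinates are indexed by numerals; the index \<open>1\<close> should not turn into \<open>Suc 0\<close>.\<close>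

declare One_nat_def [simp del]

text \<open>The coefficients of \<open>l\<^sup>2 m\<close> for linear forms \<open>l = l 0 x + l 1 y\<close> and \<open>m = m 0 x + m 1 y\<close>. The
  coefficient ring is arbitrary because \<open>l\<close> and \<open>m\<close> will also vary along a curve.\<close>

definition square_times :: "(nat \<Rightarrow> 'a::comm_ring_1) \<Rightarrow> (nat \<Rightarrow> 'a) \<Rightarrow> nat \<Rightarrow> 'a" where
  "square_times l m i =
     (if i = 0 then (l 0)^2 * m 0
      else if i = 1 then (l 0)^2 * m 1 + 2 * l 0 * l 1 * m 0
      else if i = 2 then 2 * l 0 * l 1 * m 1 + (l 1)^2 * m 0
      else if i = 3 then (l 1)^2 * m 1
      else 0)"

lemma square_times_simps:
  "square_times l m 0 = (l 0)^2 * m 0"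
  "square_times l m 1 = (l 0)^2 * m 1 + 2 * l 0 * l 1 * m 0"
  "square_times l m 2 = 2 * l 0 * l 1 * m 1 + (l 1)^2 * m 0"
  "square_times l m 3 = (l 1)^2 * m 1"
  by (simp_all add: square_times_def)

lemma square_times_scale:
  "square_times (\<lambda>i. c * l i) (\<lambda>i. c' * m i) = (\<lambda>i. (c^2 * c') * square_times l m i)"
  by (auto simp: square_times_def fun_eq_iff algebra_simps power2_eq_square)

lemma poly_square_times:
  "poly (square_times l m i) t = square_times (\<lambda>i. poly (l i) t) (\<lambda>i. poly (m i) t) i"
  by (simp add: square_times_def)

lemma nat_le_3_cases: "i \<le> (3::nat) \<longleftrightarrow> i = 0 \<or> i = 1 \<or> i = 2 \<or> i = 3"
  by auto

lemma ex_le_3: "(\<exists>i\<le>(3::nat). P i) \<longleftrightarrow> P 0 \<or> P 1 \<or> P 2 \<or> P 3"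
  unfolding nat_le_3_cases by blast

lemma ex_le_1: "(\<exists>i\<le>(1::nat). P i) \<longleftrightarrow> P 0 \<or> P 1"
  by (metis le_numeral_extra(4) less_one linorder_not_less not_less_iff_gr_or_eq order_le_less zero_le)

lemma vec_eqI_3:
  assumes "v \<in> nonzero_vecs 3" "w \<in> nonzero_vecs 3"
    and "v 0 = w 0" "v 1 = w 1" "v 2 = w 2" "v 3 = w 3"
  shows "v = w"
proof
  fix i
  show "v i = w i"
    using assms nat_le_3_cases[of i] by (cases "i \<le> 3") (auto simp: nonzero_vecs_def)
qed

lemma square_times_nonzero:
  assumes "l \<in> nonzero_vecs 1" "m \<in> nonzero_vecs 1"
  shows "square_times l m \<in> nonzero_vecs 3"
  using assms unfolding nonzero_vecs_def ex_le_3 ex_le_1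
  by (cases "l 0 = 0"; cases "m 0 = 0") (auto simp: square_times_def)

lemma cubic_disc_square_times:
  "cubic_disc (square_times l m 0) (square_times l m 1) (square_times l m 2) (square_times l m 3) = 0"
  for l m :: "nat \<Rightarrow> complex"
  unfolding square_times_simps cubic_disc_def by algebra

definition linear_form :: "complex \<Rightarrow> complex \<Rightarrow> nat \<Rightarrow> complex" where
  "linear_form s t = (\<lambda>i. if i = 0 then s else if i = 1 then t else 0)"

lemma linear_form_simps [simp]: "linear_form s t 0 = s" "linear_form s t 1 = t"
  by (simp_all add: linear_form_def)

lemma linear_form_nonzero: "s \<noteq> 0 \<or> t \<noteq> 0 \<Longrightarrow> linear_form s t \<in> nonzero_vecs 1"
  unfolding nonzero_vecs_def ex_le_1 by (auto simp: linear_form_def)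

text \<open>If \<open>v 0 \<noteq> 0\<close>, the discriminant is a product of differences of roots and two roots coincide.
  If \<open>v 0 = 0\<close>, the cubic is \<open>y\<close> times a quadratic form, and the discriminant is \<open>(v 1)\<^sup>2\<close> times that
  of the quadratic form: either this form is divisible by \<open>y\<close> too, or it is a square up to a
  constant.\<close>

lemma cubic_disc_0_imp_square_times:
  assumes v: "v \<in> nonzero_vecs 3" and disc: "cubic_disc (v 0) (v 1) (v 2) (v 3) = 0"
  shows "\<exists>l\<in>nonzero_vecs 1. \<exists>m\<in>nonzero_vecs 1. v = square_times l m"
proof -
  have *: ?thesis
    if "s \<noteq> 0 \<or> t \<noteq> 0" "p \<noteq> 0 \<or> q \<noteq> 0"
      "v 0 = s^2 * p" "v 1 = s^2 * q + 2 * s * t * p" "v 2 = 2 * s * t * q + t^2 * p" "v 3 = t^2 * q"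
    for s t p q
  proof -
    have nz: "linear_form s t \<in> nonzero_vecs 1" "linear_form p q \<in> nonzero_vecs 1"
      using that by (auto intro: linear_form_nonzero)
    have "v = square_times (linear_form s t) (linear_form p q)"
      by (rule vec_eqI_3[OF v square_times_nonzero[OF nz]])
         (use that in \<open>simp_all add: square_times_simps\<close>)
    with nz show ?thesis by blast
  qed
  show ?thesis
  proof (cases "v 0 = 0")
    case False
    then obtain \<alpha> :: "nat \<Rightarrow> complex" where \<alpha>:
      "binary_form 3 (\<lambda>i. [:v i:]) [:0, 1:] 1 = smult (v 0) (\<Prod>i=1..3. [:- \<alpha> i, 1:])"
      by (rule binary_cubic_roots_exist)
    have "\<alpha> 1 = \<alpha> 2 \<or> \<alpha> 1 = \<alpha> 3 \<or> \<alpha> 2 = \<alpha> 3"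
      using cubic_disc_roots[OF \<alpha>] disc False unfolding small_prods by auto
    then have "\<exists>x z. v 1 = - v 0 * (2 * x + z) \<and> v 2 = v 0 * (x^2 + 2 * x * z) \<and> v 3 = - v 0 * (x^2 * z)"
    proof (elim disjE)
      assume "\<alpha> 1 = \<alpha> 2"
      then show ?thesis
        using \<alpha> unfolding binary_cubic_roots_iff
        by (intro exI[of _ "\<alpha> 1"] exI[of _ "\<alpha> 3"]) (simp add: algebra_simps power2_eq_square)
    next
      assume "\<alpha> 1 = \<alpha> 3"
      then show ?thesis
        using \<alpha> unfolding binary_cubic_roots_iff
        by (intro exI[of _ "\<alpha> 1"] exI[of _ "\<alpha> 2"]) (simp add: algebra_simps power2_eq_square)
    next
      assume "\<alpha> 2 = \<alpha> 3"
      then show ?thesis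
        using \<alpha> unfolding binary_cubic_roots_iff
        by (intro exI[of _ "\<alpha> 2"] exI[of _ "\<alpha> 1"]) (simp add: algebra_simps power2_eq_square)
    qed
    then obtain x z where "v 1 = - v 0 * (2 * x + z)" "v 2 = v 0 * (x^2 + 2 * x * z)"
      "v 3 = - v 0 * (x^2 * z)" by blast
    with False show ?thesis
      by (intro *[of 1 "- x" "v 0" "- v 0 * z"]) (auto simp: algebra_simps)
  next
    case True
    have d: "(v 1)^2 * ((v 2)^2 - 4 * v 1 * v 3) = 0"
      using disc True unfolding cubic_disc_def by algebra
    show ?thesis
    proof (cases "v 1 = 0")
      case 1: True
      have "v 2 \<noteq> 0 \<or> v 3 \<noteq> 0"
        using v True 1 by (auto simp: nonzero_vecs_def ex_le_3)
      then show ?thesis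
        using True 1 by (intro *[of 0 1 "v 2" "v 3"]) auto
    next
      case False
      with d have "(v 2)^2 = 4 * v 1 * v 3" by simp
      then show ?thesis
        using True False by (intro *[of 1 "v 2 / (2 * v 1)" 0 "v 1"]) (auto simp: field_simps power2_eq_square)
    qed
  qed
qed

lemma proportional_iff:
  assumes "l \<in> nonzero_vecs 1" "l' \<in> nonzero_vecs 1"
  shows "proj_pt l = proj_pt l' \<longleftrightarrow> l 0 * l' 1 = l 1 * l' 0"
proof
  assume eq: "l 0 * l' 1 = l 1 * l' 0"
  have 0: "l i = 0" "l' i = 0" if "i \<noteq> 0" "i \<noteq> 1" for i
    using assms that by (auto simp: nonzero_vecs_def)
  show "proj_pt l = proj_pt l'"
  proof (cases "l' 0 = 0")
    case True
    then have nz: "l' 1 \<noteq> 0" "l 0 = 0" "l 1 \<noteq> 0"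
      using assms eq by (auto simp: nonzero_vecs_def ex_le_1)
    have "l = (\<lambda>i. l 1 / l' 1 * l' i)"
    proof
      fix i show "l i = l 1 / l' 1 * l' i"
        using 0[of i] True nz by (cases "i = 0"; cases "i = 1") auto
    qed
    moreover have "l 1 / l' 1 \<noteq> 0"
      using nz by simp
    ultimately show ?thesis
      unfolding proj_pt_eq_iff by blast
  next
    case False
    then have "l 0 \<noteq> 0"
      using assms eq by (auto simp: nonzero_vecs_def ex_le_1)
    have "l = (\<lambda>i. l 0 / l' 0 * l' i)"
    proof
      fix i show "l i = l 0 / l' 0 * l' i"
        using 0[of i] eq False by (cases "i = 0"; cases "i = 1") (auto simp: field_simps)
    qed
    moreover have "l 0 / l' 0 \<noteq> 0"
      using False \<open>l 0 \<noteq> 0\<close> by simp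
    ultimately show ?thesis
      unfolding proj_pt_eq_iff by blast
  qed
qed (auto simp: proj_pt_eq_iff)

text \<open>Unique factorization for \<open>l\<^sup>2 m\<close>, proved by invariants. Let \<open>e\<close> be the resultant of \<open>l\<close> and
  \<open>m\<close>. For \<open>a x\<^sup>3 + b x\<^sup>2 y + c x y\<^sup>2 + d y\<^sup>3 = l\<^sup>2 m\<close> one has
  \<open>b\<^sup>2 - 3 a c = (l 0)\<^sup>2 e\<^sup>2\<close> and \<open>b c - 9 a d = 2 l 0 l 1 e\<^sup>2\<close>, so for \<open>l 0 \<noteq> 0\<close> the
  cubic determines the ratio \<open>l 0 : l 1\<close> unless \<open>e = 0\<close>. If \<open>e = 0\<close> the cubic is a multiple of
  \<open>l\<^sup>3\<close>, and \<open>b / a\<close> gives the ratio. The case \<open>l 0 = 0\<close> is recognized by \<open>a = b = 0\<close>.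
  Once \<open>l\<close> is known, \<open>m\<close> is the quotient.\<close>

lemma proj_pt_square_times_inj:
  assumes l: "l \<in> nonzero_vecs 1" "l' \<in> nonzero_vecs 1"
    and m: "m \<in> nonzero_vecs 1" "m' \<in> nonzero_vecs 1"
    and eq: "proj_pt (square_times l m) = proj_pt (square_times l' m')"
  shows "proj_pt l = proj_pt l' \<and> proj_pt m = proj_pt m'"
proof -
  obtain k where k: "k \<noteq> 0" "square_times l m = (\<lambda>i. k * square_times l' m' i)"
    using eq unfolding proj_pt_eq_iff by auto
  define s t p q where "s = l 0" "t = l 1" "p = m 0" "q = m 1"
  define s' t' p' q' where "s' = l' 0" "t' = l' 1" "p' = m' 0" "q' = m' 1"
  note vars = s_t_p_q_def s'_t'_p'_q'_def
  have nz: "s \<noteq> 0 \<or> t \<noteq> 0" "s' \<noteq> 0 \<or> t' \<noteq> 0" "p \<noteq> 0 \<or> q \<noteq> 0" "p' \<noteq> 0 \<or> q' \<noteq> 0"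
    using l m by (auto simp: vars nonzero_vecs_def ex_le_1)
  have k0: "s^2 * p = k * (s'^2 * p')"
    and k1: "s^2 * q + 2 * s * t * p = k * (s'^2 * q' + 2 * s' * t' * p')"
    and k2: "2 * s * t * q + t^2 * p = k * (2 * s' * t' * q' + t'^2 * p')"
    and k3: "t^2 * q = k * (t'^2 * q')"
    using k(2) square_times_simps[of l m] square_times_simps[of l' m'] by (simp_all add: vars)
  have iff0: "s = 0 \<longleftrightarrow> s' = 0"
    using k0 k1 k(1) nz by auto
  have st: "s * t' = t * s'"
  proof (cases "s = 0")
    case True
    then show ?thesis using iff0 by simp
  next
    case False
    then have s': "s' \<noteq> 0" using iff0 by simp
    \<comment> \<open>the resultants of \<open>l\<close> with \<open>m\<close> and of \<open>l'\<close> with \<open>m'\<close>\<close>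
    define e e' where "e = s * q - t * p" and "e' = s' * q' - t' * p'"
    have e1: "s^2 * e^2 = k^2 * (s'^2 * e'^2)"
      using k0 k1 k2 unfolding e_def e'_def by algebra
    have e2: "s * t * e^2 = k^2 * (s' * t' * e'^2)"
      using k0 k1 k2 k3 unfolding e_def e'_def by algebra
    show ?thesis
    proof (cases "e = 0")
      case True
      with e1 k(1) s' have "e' = 0" by simp
      have p: "p \<noteq> 0" "p' \<noteq> 0"
        using True \<open>e' = 0\<close> nz False s' by (auto simp: e_def e'_def)
      have "s * (s^2 * q + 2 * s * t * p) = 3 * t * (s^2 * p)"
        "s' * (s'^2 * q' + 2 * s' * t' * p') = 3 * t' * (s'^2 * p')"
        using True \<open>e' = 0\<close> unfolding e_def e'_def by algebra+
      then have "3 * k * s'^2 * p' * (s * t' - t * s') = 0"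
        using k0 k1 by algebra
      then show ?thesis using k(1) s' p by simp
    next
      case e: False
      with e1 False have "e' \<noteq> 0" by auto
      have "k^2 * e'^2 * s' * (s * t' - t * s') = 0"
      proof -
        have "s * (k^2 * e'^2 * s' * (s * t' - t * s')) = 0"
          using e1 e2 by algebra
        then show ?thesis using False by simp
      qed
      then show ?thesis using k(1) s' \<open>e' \<noteq> 0\<close> by simp
    qed
  qed
  have pq: "p * q' = q * p'"
  proof (cases "s = 0")
    case True
    then have "s' = 0" using iff0 by simp
    then have "t^2 * p = k * (t'^2 * p')"
      using k2 True by simp
    then have "k * t'^2 * (p * q' - q * p') = 0" "t' \<noteq> 0"
      using k3 \<open>s' = 0\<close> nz by algebra+
    then show ?thesis using k(1) by simp
  next
    case False
    then have "s' \<noteq> 0" using iff0 by simp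
    have "s * (s * s' * (p * q' - q * p')) = 0"
      using k0 k1 st by algebra
    then show ?thesis using False \<open>s' \<noteq> 0\<close> by simp
  qed
  show ?thesis
    using st pq l m by (simp add: proportional_iff vars)
qed


section \<open>The discriminant surface\<close>

abbreviation disc_surface :: "(nat \<Rightarrow> complex) set set" where
  "disc_surface \<equiv> proj_zeros 3 {cubic_disc_form}"

lemma in_disc_surface_iff:
  assumes "v \<in> nonzero_vecs 3"
  shows "proj_pt v \<in> disc_surface \<longleftrightarrow> cubic_disc (v 0) (v 1) (v 2) (v 3) = 0"
  using assms cubic_disc_form_in_forms by (subst proj_pt_in_proj_zeros_iff) auto

lemma square_times_in_disc_surface:
  "square_times l m \<in> nonzero_vecs 3 \<Longrightarrow> proj_pt (square_times l m) \<in> disc_surface"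
  by (simp add: in_disc_surface_iff cubic_disc_square_times)

lemma disc_surface_cases:
  assumes "p \<in> disc_surface"
  obtains l m where "l \<in> nonzero_vecs 1" "m \<in> nonzero_vecs 1" "p = proj_pt (square_times l m)"
proof -
  from assms obtain v where v: "v \<in> nonzero_vecs 3" "p = proj_pt v"
    by (auto simp: proj_zeros_def proj_space_def)
  then show thesis
    using assms that cubic_disc_0_imp_square_times[of v] by (auto simp: in_disc_surface_iff)
qed

text \<open>Moving \<open>l\<close> and \<open>m\<close> linearly moves \<open>l\<^sup>2 m\<close> along a cubic curve on the surface.\<close>

lemma proj_variety_disc_surface: "proj_variety 3 disc_surface"
proof (rule proj_variety_if_curve_connected)
  show "zariski_closed 3 disc_surface"
    unfolding zariski_closed_def using cubic_disc_form_in_forms by (intro exI[of _ "{cubic_disc_form}"]) auto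
  have "proj_pt (square_times (linear_form 1 0) (linear_form 1 0)) \<in> disc_surface"
    by (intro square_times_in_disc_surface square_times_nonzero linear_form_nonzero) auto
  then show "disc_surface \<noteq> {}" by blast
next
  fix p q assume "p \<in> disc_surface" "q \<in> disc_surface"
  then obtain l m l' m' where lm: "l \<in> nonzero_vecs 1" "m \<in> nonzero_vecs 1" "p = proj_pt (square_times l m)"
    and lm': "l' \<in> nonzero_vecs 1" "m' \<in> nonzero_vecs 1" "q = proj_pt (square_times l' m')"
    by (meson disc_surface_cases)
  let ?c = "square_times (\<lambda>i. [:l i, l' i - l i:]) (\<lambda>i. [:m i, m' i - m i:])"
  have c: "(\<lambda>i. poly (?c i) t) =
      square_times (\<lambda>i. l i + t * (l' i - l i)) (\<lambda>i. m i + t * (m' i - m i))" for t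
    by (simp add: poly_square_times)
  show "\<exists>c :: nat \<Rightarrow> complex poly. (\<forall>i>3. c i = 0) \<and>
      (\<lambda>i. poly (c i) 0) \<in> nonzero_vecs 3 \<and> p = proj_pt (\<lambda>i. poly (c i) 0) \<and>
      (\<lambda>i. poly (c i) 1) \<in> nonzero_vecs 3 \<and> q = proj_pt (\<lambda>i. poly (c i) 1) \<and>
      (\<forall>t. (\<lambda>i. poly (c i) t) \<in> nonzero_vecs 3 \<longrightarrow> proj_pt (\<lambda>i. poly (c i) t) \<in> disc_surface)"
  proof (intro exI[of _ ?c] conjI allI impI)
    fix i :: nat assume "i > 3"
    then show "?c i = 0" by (simp add: square_times_def)
  next
    fix t assume "(\<lambda>i. poly (?c i) t) \<in> nonzero_vecs 3"
    then show "proj_pt (\<lambda>i. poly (?c i) t) \<in> disc_surface"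
      unfolding c by (rule square_times_in_disc_surface)
  qed (use lm lm' in \<open>simp_all add: c square_times_nonzero\<close>)
qed


section \<open>Rationality\<close>

text \<open>From \<open>(x + u y)\<^sup>2 (x + v y)\<close>, up to a common factor, back to \<open>(1, u, v)\<close>. The remainder of
  \<open>f = a x\<^sup>3 + b x\<^sup>2 + c x + d\<close> modulo \<open>f'\<close> is proportional to
  \<open>2 (b\<^sup>2 - 3 a c) x + (b c - 9 a d)\<close>, and it vanishes at the double root \<open>- u\<close>. Hence
  \<open>u = (b c - 9 a d) / (2 (b\<^sup>2 - 3 a c))\<close>, and \<open>v = b / a - 2 u\<close>. Here denominators are cleared.\<close>

definition double_root_map :: "nat \<Rightarrow> cpoly" where
  "double_root_map i = (let a = Var 0; b = Var 1; c = Var 2; d = Var 3 in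
     if i = 0 then 2 * a * (b^2 - 3 * a * c)
     else if i = 1 then a * (b * c - 9 * a * d)
     else 2 * (b^3 - 4 * a * b * c + 9 * a^2 * d))"

text \<open>The coefficients of \<open>(w x + u y)\<^sup>2 (w x + v y)\<close>, which is the parametrization
  \<open>(u, v) \<mapsto> (x + u y)\<^sup>2 (x + v y)\<close> made homogeneous.\<close>

definition square_times_map :: "nat \<Rightarrow> cpoly" where
  "square_times_map i = (let w = Var 0; u = Var 1; v = Var 2 in
     if i = 0 then w^3
     else if i = 1 then w^2 * v + 2 * w^2 * u
     else if i = 2 then 2 * w * u * v + w * u^2
     else u^2 * v)"

lemma double_root_map_forms: "double_root_map i \<in> forms 3 3"
proof -
  let ?a = "Var 0" and ?b = "Var 1" and ?c = "Var 2" and ?d = "Var 3"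
  have "2 * ?a * (?b^2 - 3 * ?a * ?c) \<in> forms 3 3" "?a * (?b * ?c - 9 * ?a * ?d) \<in> forms 3 3"
    "2 * (?b^3 - 4 * ?a * ?b * ?c + 9 * ?a^2 * ?d) \<in> forms 3 3"
    by (rule forms_intros | simp)+
  then show ?thesis
    by (simp add: double_root_map_def Let_def)
qed

lemma square_times_map_forms: "square_times_map i \<in> forms 2 3"
proof -
  let ?w = "Var 0" and ?u = "Var 1" and ?v = "Var 2"
  have "?w^3 \<in> forms 2 3" "?w^2 * ?v + 2 * ?w^2 * ?u \<in> forms 2 3"
    "2 * ?w * ?u * ?v + ?w * ?u^2 \<in> forms 2 3" "?u^2 * ?v \<in> forms 2 3"
    by (rule forms_intros | simp)+
  then show ?thesis
    by (simp add: square_times_map_def Let_def)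
qed

lemma nat_le_2_cases: "i \<le> (2::nat) \<longleftrightarrow> i = 0 \<or> i = 1 \<or> i = 2"
  by auto

lemma ex_le_2: "(\<exists>i\<le>(2::nat). P i) \<longleftrightarrow> P 0 \<or> P 1 \<or> P 2"
  unfolding nat_le_2_cases by blast

lemma square_times_map_eval:
  "ceval v (square_times_map 0) = v 0 ^ 3"
  "ceval v (square_times_map 1) = (v 0)^2 * v 2 + 2 * (v 0)^2 * v 1"
  "ceval v (square_times_map 2) = 2 * v 0 * v 1 * v 2 + v 0 * (v 1)^2"
  "ceval v (square_times_map 3) = (v 1)^2 * v 2"
  by (simp_all add: square_times_map_def Let_def)

lemma square_times_map_apply:
  "v 0 \<noteq> 0 \<Longrightarrow> apply_forms 3 square_times_map v =
    (\<lambda>i. v 0 ^ 3 * square_times (linear_form 1 (v 1 / v 0)) (linear_form 1 (v 2 / v 0)) i)"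
proof
  assume v: "v 0 \<noteq> 0"
  fix i :: nat
  show "apply_forms 3 square_times_map v i =
    v 0 ^ 3 * square_times (linear_form 1 (v 1 / v 0)) (linear_form 1 (v 2 / v 0)) i"
  proof (cases "i \<le> 3")
    case True
    then show ?thesis
      unfolding nat_le_3_cases using v
      by (elim disjE) (simp_all add: apply_forms_def square_times_map_eval square_times_simps
          field_simps power2_eq_square power3_eq_cube)
  next
    case False
    then show ?thesis by (simp add: apply_forms_def square_times_def)
  qed
qed

lemma square_times_map_apply_0:
  "v 0 = 0 \<Longrightarrow> apply_forms 3 square_times_map v = (\<lambda>i. if i = 3 then (v 1)^2 * v 2 else 0)"
  using nat_le_3_cases by (auto simp: apply_forms_def square_times_map_eval fun_eq_iff)

lemma double_root_map_eval:
  "ceval v (double_root_map 0) = 2 * v 0 * ((v 1)^2 - 3 * v 0 * v 2)"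
  "ceval v (double_root_map 1) = v 0 * (v 1 * v 2 - 9 * v 0 * v 3)"
  "ceval v (double_root_map 2) = 2 * ((v 1)^3 - 4 * v 0 * v 1 * v 2 + 9 * (v 0)^2 * v 3)"
  by (simp_all add: double_root_map_def Let_def)

lemma double_root_map_apply:
  assumes "l 0 = 1" "m 0 = 1"
  shows "apply_forms 2 double_root_map (square_times l m) =
    (\<lambda>i. 2 * (l 1 - m 1)^2 * (if i = 0 then 1 else if i = 1 then l 1 else if i = 2 then m 1 else 0))"
proof -
  have e: "ceval (square_times l m) (double_root_map 0) = 2 * (l 1 - m 1)^2"
    "ceval (square_times l m) (double_root_map 1) = 2 * (l 1 - m 1)^2 * l 1"
    "ceval (square_times l m) (double_root_map 2) = 2 * (l 1 - m 1)^2 * m 1"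
    using assms unfolding double_root_map_eval square_times_simps by algebra+
  show ?thesis
  proof
    fix i :: nat
    show "apply_forms 2 double_root_map (square_times l m) i =
      2 * (l 1 - m 1)^2 * (if i = 0 then 1 else if i = 1 then l 1 else if i = 2 then m 1 else 0)"
      using e nat_le_2_cases[of i] by (auto simp: apply_forms_def)
  qed
qed


lemma nonzero_vecs_scale_iff: "(\<lambda>i. c * v i) \<in> nonzero_vecs n \<longleftrightarrow> c \<noteq> 0 \<and> v \<in> nonzero_vecs n"
  by (auto simp: nonzero_vecs_def)

lemmas disc_surface_rat_simps =
  rat_apply_proj_pt[OF double_root_map_forms] rat_defined_proj_pt[OF double_root_map_forms]
  rat_apply_proj_pt[OF square_times_map_forms] rat_defined_proj_pt[OF square_times_map_forms]

text \<open>The composite of the two maps is undefined where \<open>l 0 = 0\<close> or \<open>m 0 = 0\<close>: there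
  \<open>double_root_map\<close> gives at best the point \<open>(0, 0, 1)\<close>, at which \<open>square_times_map\<close> vanishes. So
  both factors can be normalized to leading coefficient \<open>1\<close>.\<close>

lemma disc_surface_affine:
  assumes "p \<in> disc_surface"
    "rat_defined 3 square_times_map (rat_apply 2 double_root_map p)"
  obtains l m where "l \<in> nonzero_vecs 1" "m \<in> nonzero_vecs 1" "l 0 = 1" "m 0 = 1" "p = proj_pt (square_times l m)"
proof -
  obtain l m where lm: "l \<in> nonzero_vecs 1" "m \<in> nonzero_vecs 1" "p = proj_pt (square_times l m)"
    using assms(1) by (rule disc_surface_cases)
  have "l 0 \<noteq> 0 \<and> m 0 \<noteq> 0"
  proof (rule ccontr)
    assume *: "\<not> (l 0 \<noteq> 0 \<and> m 0 \<noteq> 0)"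
    let ?w = "apply_forms 2 double_root_map (square_times l m)"
    have "?w 0 = 0" "?w 1 = 0"
      using * by (auto simp: apply_forms_def double_root_map_eval square_times_simps)
    then have "apply_forms 3 square_times_map ?w \<notin> nonzero_vecs 3"
      by (simp add: square_times_map_apply_0 nonzero_vecs_def)
    then show False
      using assms(2) lm(3) double_root_map_forms square_times_map_forms
      by (simp add: rat_apply_proj_pt[of _ _ 3 3] rat_defined_proj_pt[of _ _ 2 3])
  qed
  then have "p = proj_pt (square_times (\<lambda>i. inverse (l 0) * l i) (\<lambda>i. inverse (m 0) * m i))"
    unfolding square_times_scale lm(3) by (simp add: proj_pt_scale)
  then show thesis
    using that[of "\<lambda>i. inverse (l 0) * l i" "\<lambda>i. inverse (m 0) * m i"] lm
      \<open>l 0 \<noteq> 0 \<and> m 0 \<noteq> 0\<close> by (simp add: nonzero_vecs_scale_iff)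
qed

lemma nonzero_vecs_1_eq_linear_form:
  "l \<in> nonzero_vecs 1 \<Longrightarrow> l = linear_form (l 0) (l 1)"
  by (auto simp: nonzero_vecs_def linear_form_def fun_eq_iff)

lemma proj_space_2_eqI:
  assumes "v \<in> nonzero_vecs 2" "v 0 \<noteq> 0"
  shows "proj_pt (\<lambda>i. if i = 0 then 1 else if i = 1 then v 1 / v 0 else if i = 2 then v 2 / v 0 else 0) = proj_pt v"
proof -
  have "(\<lambda>i. if i = 0 then 1 else if i = 1 then v 1 / v 0 else if i = 2 then v 2 / v 0 else 0)
     = (\<lambda>i. inverse (v 0) * v i)"
  proof
    fix i
    show "(if i = 0 then 1 else if i = 1 then v 1 / v 0 else if i = 2 then v 2 / v 0 else 0) =
      inverse (v 0) * v i"
      using assms nat_le_2_cases[of i] by (auto simp: nonzero_vecs_def field_simps)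
  qed
  then show ?thesis
    using assms by (simp add: proj_pt_scale)
qed

lemma double_root_map_apply_affine:
  assumes "l 0 = 1" "m 0 = 1" "l 1 \<noteq> m 1"
  shows "apply_forms 2 double_root_map (square_times l m) \<in> nonzero_vecs 2"
  using assms unfolding double_root_map_apply[of l m, OF assms(1,2)] nonzero_vecs_scale_iff
  by (auto simp: nonzero_vecs_def ex_le_2)

lemma square_times_map_double_root_map:
  assumes lm: "l \<in> nonzero_vecs 1" "m \<in> nonzero_vecs 1" "l 0 = 1" "m 0 = 1" "l 1 \<noteq> m 1"
  shows "rat_defined 3 square_times_map (proj_pt (apply_forms 2 double_root_map (square_times l m)))"
    "rat_apply 3 square_times_map (proj_pt (apply_forms 2 double_root_map (square_times l m)))
      = proj_pt (square_times l m)"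
proof -
  define w where "w = apply_forms 2 double_root_map (square_times l m)"
  have w: "w = (\<lambda>i. 2 * (l 1 - m 1)^2 * (if i = 0 then 1 else if i = 1 then l 1 else if i = 2 then m 1 else 0))"
    using lm by (simp add: w_def double_root_map_apply)
  then have "w 0 \<noteq> 0" "w 1 / w 0 = l 1" "w 2 / w 0 = m 1"
    using lm by simp_all
  then have *: "apply_forms 3 square_times_map w = (\<lambda>i. w 0 ^ 3 * square_times l m i)"
    using nonzero_vecs_1_eq_linear_form[OF lm(1)] nonzero_vecs_1_eq_linear_form[OF lm(2)] lm
    by (simp add: square_times_map_apply)
  show "rat_defined 3 square_times_map (proj_pt (apply_forms 2 double_root_map (square_times l m)))"
    "rat_apply 3 square_times_map (proj_pt (apply_forms 2 double_root_map (square_times l m)))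
      = proj_pt (square_times l m)"
    using \<open>w 0 \<noteq> 0\<close> lm unfolding w_def[symmetric]
    by (simp_all add: disc_surface_rat_simps * nonzero_vecs_scale_iff square_times_nonzero proj_pt_scale)
qed

lemma rational_map_double_root_map:
  "rational_map 3 disc_surface 2 (proj_space 2) double_root_map"
  unfolding rational_map_def
proof (intro conjI ballI impI)
  show "\<exists>d. \<forall>i\<le>2. double_root_map i \<in> forms 3 d"
    using double_root_map_forms by blast
  have "proj_pt (square_times (linear_form 1 0) (linear_form 1 1)) \<in> disc_surface"
    by (intro square_times_in_disc_surface square_times_nonzero linear_form_nonzero) auto
  then show "\<exists>p\<in>disc_surface. rat_defined 2 double_root_map p"
    by (rule bexI[rotated]) (simp add: disc_surface_rat_simps double_root_map_apply_affine)
next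
  fix p assume "p \<in> disc_surface" "rat_defined 2 double_root_map p"
  then show "rat_apply 2 double_root_map p \<in> proj_space 2"
    by (elim disc_surface_cases) (simp add: disc_surface_rat_simps proj_pt_in_proj_space)
qed

lemma cubic_disc_square_times_map:
  "cubic_disc (ceval v (square_times_map 0)) (ceval v (square_times_map 1))
     (ceval v (square_times_map 2)) (ceval v (square_times_map 3)) = 0"
  unfolding square_times_map_eval cubic_disc_def by algebra

lemma rational_map_square_times_map:
  "rational_map 2 (proj_space 2) 3 disc_surface square_times_map"
  unfolding rational_map_def
proof (intro conjI ballI impI)
  show "\<exists>d. \<forall>i\<le>3. square_times_map i \<in> forms 2 d"
    using square_times_map_forms by blast
  have "linear_form 1 0 \<in> nonzero_vecs 2"
    by (auto simp: nonzero_vecs_def linear_form_def)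
  moreover have "apply_forms 3 square_times_map (linear_form 1 0) \<in> nonzero_vecs 3"
    by (simp add: square_times_map_apply nonzero_vecs_scale_iff square_times_nonzero linear_form_nonzero)
  ultimately show "\<exists>p\<in>proj_space 2. rat_defined 3 square_times_map p"
    by (intro bexI[of _ "proj_pt (linear_form 1 0)"])
       (simp_all add: disc_surface_rat_simps proj_pt_in_proj_space)
next
  fix p assume "p \<in> proj_space 2" and def: "rat_defined 3 square_times_map p"
  then obtain v where v: "p = proj_pt v"
    by (auto simp: proj_space_def)
  then show "rat_apply 3 square_times_map p \<in> disc_surface"
    using def cubic_disc_square_times_map[of v]
    by (simp add: disc_surface_rat_simps in_disc_surface_iff apply_forms_def)
qed

text \<open>Where the composite is defined, the two factors are not proportional: at the cubes
  \<open>l\<^sup>3\<close> all components of \<open>double_root_map\<close> vanish.\<close>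

lemma left_inverse_square_times_map:
  "rat_left_inverse 3 disc_surface 2 square_times_map double_root_map"
  unfolding rat_left_inverse_def
proof (intro conjI ballI impI)
  have nz: "linear_form 1 0 \<in> nonzero_vecs 1" "linear_form 1 1 \<in> nonzero_vecs 1"
    by (auto intro: linear_form_nonzero)
  then have "proj_pt (square_times (linear_form 1 0) (linear_form 1 1)) \<in> disc_surface"
    by (intro square_times_in_disc_surface square_times_nonzero)
  then show "\<exists>p\<in>disc_surface. rat_defined 2 double_root_map p \<and>
      rat_defined 3 square_times_map (rat_apply 2 double_root_map p)"
    using square_times_map_double_root_map(1)[OF nz]
    by (intro bexI[of _ "proj_pt (square_times (linear_form 1 0) (linear_form 1 1))"])
       (simp_all add: rat_apply_proj_pt[OF double_root_map_forms]
          rat_defined_proj_pt[OF double_root_map_forms] double_root_map_apply_affine)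
next
  fix p assume p: "p \<in> disc_surface" and def: "rat_defined 2 double_root_map p \<and>
      rat_defined 3 square_times_map (rat_apply 2 double_root_map p)"
  then obtain l m where lm: "l \<in> nonzero_vecs 1" "m \<in> nonzero_vecs 1" "l 0 = 1" "m 0 = 1"
    "p = proj_pt (square_times l m)"
    by (meson disc_surface_affine)
  have "apply_forms 2 double_root_map (square_times l m) \<in> nonzero_vecs 2"
    using def by (simp add: lm(5) disc_surface_rat_simps)
  then have "l 1 \<noteq> m 1"
    unfolding double_root_map_apply[of l m, OF lm(3,4)] nonzero_vecs_scale_iff by auto
  then show "rat_apply 3 square_times_map (rat_apply 2 double_root_map p) = p"
    using square_times_map_double_root_map(2)[OF lm(1-4)]
    by (simp add: lm(5) rat_apply_proj_pt[OF double_root_map_forms])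
qed

lemma left_inverse_double_root_map:
  "rat_left_inverse 2 (proj_space 2) 3 double_root_map square_times_map"
  unfolding rat_left_inverse_def
proof (intro conjI ballI impI)
  have comp: "apply_forms 2 double_root_map (apply_forms 3 square_times_map v) =
      (\<lambda>i. v 0 ^ 9 * (2 * (v 1 / v 0 - v 2 / v 0)\<^sup>2 *
        (if i = 0 then 1 else if i = 1 then v 1 / v 0 else if i = 2 then v 2 / v 0 else 0)))"
    if "v 0 \<noteq> 0" for v
    unfolding square_times_map_apply[of v, OF that] apply_forms_homogeneous[OF double_root_map_forms]
    by (simp add: double_root_map_apply cong: if_cong)
  show "\<exists>p\<in>proj_space 2. rat_defined 3 square_times_map p \<and>
      rat_defined 2 double_root_map (rat_apply 3 square_times_map p)"
  proof (intro bexI[of _ "proj_pt (linear_form 1 1)"] conjI)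
    have nz: "linear_form 1 1 \<in> nonzero_vecs 2"
      by (auto simp: nonzero_vecs_def linear_form_def)
    then show "proj_pt (linear_form 1 1) \<in> proj_space 2"
      by (rule proj_pt_in_proj_space)
    show "rat_defined 3 square_times_map (proj_pt (linear_form 1 1))"
      by (simp add: disc_surface_rat_simps square_times_map_apply nonzero_vecs_scale_iff
          square_times_nonzero linear_form_nonzero)
    show "rat_defined 2 double_root_map (rat_apply 3 square_times_map (proj_pt (linear_form 1 1)))"
      by (simp add: disc_surface_rat_simps comp)
         (auto simp: nonzero_vecs_def ex_le_2 linear_form_def)
  qed
  fix p assume "p \<in> proj_space 2" and def: "rat_defined 3 square_times_map p \<and>
      rat_defined 2 double_root_map (rat_apply 3 square_times_map p)"
  then obtain v where v: "v \<in> nonzero_vecs 2" "p = proj_pt v"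
    by (auto simp: proj_space_def)
  let ?w = "apply_forms 2 double_root_map (apply_forms 3 square_times_map v)"
  have w: "?w \<in> nonzero_vecs 2"
    using def by (simp add: v(2) disc_surface_rat_simps)
  have v0: "v 0 \<noteq> 0"
  proof
    assume "v 0 = 0"
    then have "?w i = 0" for i
      using nat_le_2_cases[of i]
      by (cases "i \<le> 2") (auto simp: square_times_map_apply_0 apply_forms_def[of 2] double_root_map_eval)
    with w show False by (simp add: nonzero_vecs_def)
  qed
  have "proj_pt ?w = proj_pt v"
    using w unfolding comp[of v, OF v0] nonzero_vecs_scale_iff
    by (simp add: proj_pt_scale proj_space_2_eqI[OF v(1) v0])
  then show "rat_apply 2 double_root_map (rat_apply 3 square_times_map p) = p"
    by (simp add: v(2) disc_surface_rat_simps)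
qed

lemma rational_disc_surface: "rational_surface 3 disc_surface"
  unfolding rational_surface_def birational_def
  using proj_variety_disc_surface proj_variety_proj_space rational_map_double_root_map
    rational_map_square_times_map left_inverse_square_times_map left_inverse_double_root_map
  by blast


section \<open>The homeomorphism\<close>

lemma continuous_square_times:
  "continuous_on A (\<lambda>z. square_times (fst z) (snd z) :: nat \<Rightarrow> complex)"
proof (intro continuous_on_coordinatewise_then_product)
  have coord: "continuous_on A (\<lambda>z. fst z i)" "continuous_on A (\<lambda>z. snd z i)" for i
    and A :: "((nat \<Rightarrow> complex) \<times> (nat \<Rightarrow> complex)) set"
    by (rule continuous_on_product_then_coordinatewise[OF continuous_on_fst[OF continuous_on_id]]
        continuous_on_product_then_coordinatewise[OF continuous_on_snd[OF continuous_on_id]])+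
  fix i
  show "continuous_on A (\<lambda>z. square_times (fst z) (snd z) i :: complex)"
    unfolding square_times_def
    by (cases "i = 0"; cases "i = 1"; cases "i = 2"; cases "i = 3"; simp)
       (intro continuous_intros coord)+
qed

lemma quotient_maps_same_fibres_homeomorphic:
  assumes f: "quotient_map X Y f" and g: "quotient_map X Z g"
    and eq: "\<And>x y. x \<in> topspace X \<Longrightarrow> y \<in> topspace X \<Longrightarrow> f x = f y \<longleftrightarrow> g x = g y"
  shows "Y homeomorphic_space Z"
proof -
  obtain h where h: "continuous_map Y Z h" "\<And>x. x \<in> topspace X \<Longrightarrow> h (f x) = g x"
    using quotient_map_lift_exists[OF f quotient_imp_continuous_map[OF g]] eq by metis
  obtain k where k: "continuous_map Z Y k" "\<And>x. x \<in> topspace X \<Longrightarrow> k (g x) = f x"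
    using quotient_map_lift_exists[OF g quotient_imp_continuous_map[OF f]] eq by metis
  have "f ` topspace X = topspace Y" "g ` topspace X = topspace Z"
    using f g by (simp_all add: quotient_imp_surjective_map)
  then have "homeomorphic_maps Y Z h k"
    using h k unfolding homeomorphic_maps_def by force
  then show ?thesis
    by (auto simp: homeomorphic_space_def)
qed

text \<open>Pairs of normalized vectors form a compact space \<open>K\<close>. Both \<open>(l, m) \<mapsto> [l\<^sup>2 m]\<close> and
  \<open>(l, m) \<mapsto> ([l], [m])\<close> are continuous surjections from \<open>K\<close> to Hausdorff spaces, hence quotient
  maps, and by unique factorization they have the same fibres. Working on \<open>K\<close> avoids the question
  whether a product of quotient maps is a quotient map.\<close>

lemma disc_surface_homeomorphic:
  "subtopology (proj_topology 3) disc_surface homeomorphic_space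
     prod_topology (proj_topology 1) (proj_topology 1)"
proof (rule quotient_maps_same_fibres_homeomorphic)
  let ?K = "top_of_set (unit_vecs 1 \<times> unit_vecs 1)"
  let ?f = "\<lambda>z. proj_pt (square_times (fst z) (snd z))"
  let ?g = "\<lambda>z. (proj_pt (fst z), proj_pt (snd z))"
  have K: "compact_space ?K"
    by (simp add: compact_space_subtopology compact_Times compact_unit_vecs)
  have nz: "fst z \<in> nonzero_vecs 1" "snd z \<in> nonzero_vecs 1" if "z \<in> unit_vecs 1 \<times> unit_vecs 1" for z
    using that subsetD[OF unit_vecs_subset] by auto
  have proj_pt_cont: "continuous_map (top_of_set (nonzero_vecs n)) (proj_topology n) proj_pt" for n
    by (rule quotient_imp_continuous_map[OF quotient_map_proj_pt])
  show "quotient_map ?K (subtopology (proj_topology 3) disc_surface) ?f"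
  proof (rule continuous_imp_quotient_map)
    have "continuous_map ?K (top_of_set (nonzero_vecs 3)) (\<lambda>z. square_times (fst z) (snd z))"
      using nz by (auto simp: continuous_map_in_subtopology continuous_square_times square_times_nonzero
          simp del: mem_Times_iff)
    from continuous_map_compose[OF this proj_pt_cont]
    have "continuous_map ?K (proj_topology 3) ?f"
      by (simp add: o_def)
    then show "continuous_map ?K (subtopology (proj_topology 3) disc_surface) ?f"
      using nz by (auto simp: continuous_map_in_subtopology square_times_in_disc_surface square_times_nonzero)
    show "Hausdorff_space (subtopology (proj_topology 3) disc_surface)"
      by (intro Hausdorff_space_subtopology Hausdorff_proj_topology)
    show "?f ` topspace ?K = topspace (subtopology (proj_topology 3) disc_surface)"
    proof
      show "?f ` topspace ?K \<subseteq> topspace (subtopology (proj_topology 3) disc_surface)"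
        using nz by (auto simp: square_times_in_disc_surface square_times_nonzero proj_pt_in_proj_space)
      show "topspace (subtopology (proj_topology 3) disc_surface) \<subseteq> ?f ` topspace ?K"
      proof
        fix p assume "p \<in> topspace (subtopology (proj_topology 3) disc_surface)"
        then have "p \<in> disc_surface" by simp
        then obtain l m where lm: "l \<in> nonzero_vecs 1" "m \<in> nonzero_vecs 1" "p = proj_pt (square_times l m)"
          by (rule disc_surface_cases)
        then have "proj_pt l \<in> proj_pt ` unit_vecs 1" "proj_pt m \<in> proj_pt ` unit_vecs 1"
          by (simp_all add: proj_pt_unit_vecs proj_pt_in_proj_space)
        then obtain l' m' c c' where u: "l' \<in> unit_vecs 1" "m' \<in> unit_vecs 1"
          "c \<noteq> 0" "l = (\<lambda>i. c * l' i)" "c' \<noteq> 0" "m = (\<lambda>i. c' * m' i)"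
          by (auto simp: proj_pt_eq_iff)
        then have "p = ?f (l', m')"
          by (simp add: lm(3) square_times_scale proj_pt_scale)
        with u(1,2) show "p \<in> ?f ` topspace ?K"
          by (intro image_eqI[of _ _ "(l', m')"]) auto
      qed
    qed
  qed (rule K)
  show "quotient_map ?K (prod_topology (proj_topology 1) (proj_topology 1)) ?g"
  proof (rule continuous_imp_quotient_map)
    have "continuous_map ?K (top_of_set (nonzero_vecs 1)) fst"
      "continuous_map ?K (top_of_set (nonzero_vecs 1)) snd"
      using nz by (auto simp: continuous_map_in_subtopology continuous_on_fst continuous_on_snd
          continuous_on_id)
    from continuous_map_compose[OF this(1) proj_pt_cont] continuous_map_compose[OF this(2) proj_pt_cont]
    show "continuous_map ?K (prod_topology (proj_topology 1) (proj_topology 1)) ?g"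
      by (simp add: continuous_map_pairwise o_def)
    show "Hausdorff_space (prod_topology (proj_topology 1) (proj_topology 1))"
      by (simp add: Hausdorff_space_prod_topology Hausdorff_proj_topology)
    have "?g ` (unit_vecs 1 \<times> unit_vecs 1) = (proj_pt ` unit_vecs 1) \<times> (proj_pt ` unit_vecs 1)"
      by force
    then show "?g ` topspace ?K = topspace (prod_topology (proj_topology 1) (proj_topology 1))"
      by (simp add: proj_pt_unit_vecs)
  qed (rule K)
  fix x y assume xy: "x \<in> topspace ?K" "y \<in> topspace ?K"
  show "?f x = ?f y \<longleftrightarrow> ?g x = ?g y"
  proof
    assume "?f x = ?f y"
    moreover have "x \<in> unit_vecs 1 \<times> unit_vecs 1" "y \<in> unit_vecs 1 \<times> unit_vecs 1"
      using xy by simp_all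
    ultimately show "?g x = ?g y"
      using proj_pt_square_times_inj[of "fst x" "fst y" "snd x" "snd y"] nz[of x] nz[of y]
      by (simp only: prod.inject)
  next
    assume "?g x = ?g y"
    then obtain c c' where "c \<noteq> 0" "fst x = (\<lambda>i. c * fst y i)" "c' \<noteq> 0" "snd x = (\<lambda>i. c' * snd y i)"
      by (auto simp: proj_pt_eq_iff)
    then show "?f x = ?f y"
      by (simp add: square_times_scale proj_pt_scale)
  qed
qed


section \<open>Multiplicities\<close>

text \<open>Restricted to a line through the origin, a polynomial of order greater than \<open>k\<close> is divisible by
  \<open>t ^ (k + 1)\<close>. So a single nonzero coefficient on a suitable line bounds the order, and the
  local equation need not be expanded.\<close>

lemma order_at_origin_le:
  assumes "coeff (cpoly_subst (\<lambda>c. [:c:]) (\<lambda>i. [:0, w i:]) F) k \<noteq> 0"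
  shows "order_at_origin F \<le> enat k"
proof -
  have "\<exists>m\<in>Poly_Mapping.keys F. monom_deg m \<le> k"
  proof (rule ccontr)
    assume "\<not> ?thesis"
    then have deg: "k < monom_deg m" if "m \<in> Poly_Mapping.keys F" for m
      using that by auto
    have val: "monom_val (\<lambda>i. [:0, w i:]) m =
        Polynomial.monom 1 (monom_deg m) * monom_val (\<lambda>i. [:w i:]) m" for m
      using monom_val_scale[of "Polynomial.monom 1 1" "\<lambda>i. [:w i:]" m]
      by (simp add: monom_altdef)
    have "coeff (cpoly_subst (\<lambda>c. [:c:]) (\<lambda>i. [:0, w i:]) F) k = 0"
      unfolding poly_coeff.cpoly_subst_alt coeff_sum val
      by (intro sum.neutral ballI) (use deg in \<open>simp add: coeff_monom_mult\<close>)
    with assms show False by simp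
  qed
  then obtain m where m: "m \<in> Poly_Mapping.keys F" "monom_deg m \<le> k" by blast
  have "order_at_origin F \<le> enat (monom_deg m)"
    unfolding order_at_origin_def by (rule INF_lower[OF m(1)])
  also have "\<dots> \<le> enat k" using m(2) by simp
  finally show ?thesis .
qed

lemma subst_local_equation:
  "cpoly_subst (\<lambda>c. [:c:]) (\<lambda>i. [:0, w i:]) (local_equation i v cubic_disc_form) =
    cubic_disc (if 0 = i then 1 else [:v 0 / v i, w 0:]) (if 1 = i then 1 else [:v 1 / v i, w 1:])
      (if 2 = i then 1 else [:v 2 / v i, w 2:]) (if 3 = i then 1 else [:v 3 / v i, w 3:])"
  by (simp add: local_equation_def)

text \<open>Let the first nonzero coordinate of the point be set to \<open>1\<close>. If it is \<open>a\<close>, the term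
  \<open>- 27 a\<^sup>2 d\<^sup>2\<close> gives order at most \<open>2\<close> in the direction of \<open>d\<close>. If it is \<open>b\<close>, then \<open>a = 0\<close> and
  \<open>- 4 b\<^sup>3 d\<close> is the only term containing \<open>d\<close> on that line. If it is \<open>c\<close>, then \<open>a = b = 0\<close> and
  \<open>- 4 a c\<^sup>3\<close> is a nonzero linear term in the direction of \<open>a\<close>. If it is \<open>d\<close>, the others vanish and
  \<open>- 27 a\<^sup>2 d\<^sup>2\<close> gives order \<open>2\<close> in the direction of \<open>a\<close>.\<close>

lemma multiplicity_le:
  assumes p: "p \<in> disc_surface"
  shows "multiplicity_at cubic_disc_form p \<le> 2"
proof -
  define v where "v = (SOME v. v \<in> p)"
  obtain w where w: "w \<in> nonzero_vecs 3" "p = proj_pt w"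
    using p by (auto simp: proj_zeros_def proj_space_def)
  have "v \<in> p"
    unfolding v_def by (rule someI[of _ w]) (simp add: w(2) proj_pt_self)
  then obtain c where "c \<noteq> 0" "v = (\<lambda>i. c * w i)"
    unfolding w(2) by (auto simp: proj_pt_def)
  then have v: "v \<in> nonzero_vecs 3"
    using w(1) by (simp add: nonzero_vecs_scale_iff)
  define i where "i = (LEAST i. v i \<noteq> 0)"
  obtain j where j: "j \<le> 3" "v j \<noteq> 0"
    using v by (auto simp: nonzero_vecs_def)
  have vi: "v i \<noteq> 0" "i \<le> j"
    unfolding i_def using j(2) by (rule LeastI, rule Least_le)
  have less: "v k = 0" if "k < i" for k
    using that not_less_Least unfolding i_def by blast
  let ?G = "local_equation i v cubic_disc_form"
  note eq = subst_local_equation[of _ i v]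
  note calc = cubic_disc_def power2_eq_square power3_eq_cube numeral_poly coeff_pCons
    numeral_2_eq_2 one_pCons One_nat_def
  have "order_at_origin ?G \<le> enat 2"
  proof -
    consider "i = 0" | "i = 1" | "i = 2" | "i = 3"
      using vi(2) j(1) nat_le_3_cases[of i] by auto
    then show ?thesis
    proof cases
      case 1
      have "coeff (cpoly_subst (\<lambda>c. [:c:]) (\<lambda>k. [:0, if k = 3 then 1 else 0:]) ?G) 2 \<noteq> 0"
        unfolding eq by (simp add: 1 calc)
      from order_at_origin_le[OF this] show ?thesis by simp
    next
      case 2
      then have "v 0 = 0" using less by simp
      then have "coeff (cpoly_subst (\<lambda>c. [:c:]) (\<lambda>k. [:0, if k = 3 then 1 else 0:]) ?G) 1 \<noteq> 0"
        unfolding eq by (simp add: 2 calc)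
      from order_at_origin_le[OF this] show ?thesis
        by (rule order_trans) simp
    next
      case 3
      then have "v 0 = 0" "v 1 = 0" using less by simp_all
      then have "coeff (cpoly_subst (\<lambda>c. [:c:]) (\<lambda>k. [:0, if k = 0 then 1 else 0:]) ?G) 1 \<noteq> 0"
        unfolding eq by (simp add: 3 calc)
      from order_at_origin_le[OF this] show ?thesis
        by (rule order_trans) simp
    next
      case 4
      then have "v 0 = 0" "v 1 = 0" "v 2 = 0" using less by simp_all
      then have "coeff (cpoly_subst (\<lambda>c. [:c:]) (\<lambda>k. [:0, if k = 0 then 1 else 0:]) ?G) 2 \<noteq> 0"
        unfolding eq by (simp add: 4 calc)
      from order_at_origin_le[OF this] show ?thesis by simp
    qed
  qed
  then show ?thesis
    unfolding multiplicity_at_def Let_def v_def[symmetric] i_def[symmetric] numeral_eq_enat .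
qed

theorem proposition4p14:
  shows "(let a = Var 0; b = Var 1; c = Var 2; d = Var 3 in
            discriminant 3 =
              b^2 * c^2 - 4 * a * c^3 - 4 * b^3 * d + 18 * a * b * c * d - 27 * a^2 * d^2) \<and>
         (let D\<^sub>3 = proj_zeros 3 {discriminant 3} in
            rational_surface 3 D\<^sub>3 \<and>
            subtopology (proj_topology 3) D\<^sub>3 homeomorphic_space
              prod_topology (proj_topology 1) (proj_topology 1) \<and>
            (\<forall>p\<in>D\<^sub>3. multiplicity_at (discriminant 3) p \<le> 2))"
  unfolding Let_def discriminant_3
  using rational_disc_surface disc_surface_homeomorphic multiplicity_le
  by (simp add: cubic_disc_def)

end
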